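(* For every prime power $q \geq 4$, the graph $H_q$ (which has $q^4-q^3+q^2$ vertices) is quasi-Folkman with distinguished family $\mathscr{T}_q$; that is, no four triangles in $\mathscr{T}_q$ induce a $K_4$ in $H_q$, and every two-coloring of $E(H_q)$ induces a monochromatic triangle belonging to $\mathscr{T}_q$. Moreover, as $q \to \infty$ (over prime powers), every two-coloring of $E(H_q)$ induces at least $(\tfrac14 - o(1))|\mathscr{T}_q|$ monochromatic triangles belonging to $\mathscr{T}_q$.
   Context: Let $q$ be a prime power and $PG(2,q^2)$ the projective plane over $\mathbb{F}_{q^2}$. The Hermitian unital is $\mathscr{U}_q = \{\langle X,Y,Z\rangle : X^{q+1}+Y^{q+1}+Z^{q+1}=0\}$, a set of points of $PG(2,q^2)$ (here $\langle X,Y,Z\rangle$ is the 1-dimensional subspace spanned by a nonzero vector of $\mathbb{F}_{q^2}^3$). Every line of $PG(2,q^2)$ meets $\mathscr{U}_q$ in exactly $1$ or exactly $q+1$ points; lines meeting it in $q+1$ points are called secants, and $\mathscr{L}_q$ denotes the set of secants. The graph $H_q$ has vertex set $\{v_\ell : \ell \in \mathscr{L}_q\}$, with $v_{\ell_1} \sim v_{\ell_2}$ iff $\ell_1 \neq \ell_2$ and $\ell_1 \cap \ell_2 \in \mathscr{U}_q$. A triangle $v_{\ell_1}v_{\ell_2}v_{\ell_3}$ of $H_q$ is non-degenerate if the three points $\ell_1\cap\ell_2$, $\ell_2\cap\ell_3$, $\ell_1\cap\ell_3$ (all in $\mathscr{U}_q$) are pairwise distinct; $\mathscr{T}_q$ is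 the set of non-degenerate triangles of $H_q$. A graph $G$ is quasi-Folkman if there is a family $\mathscr{T}$ of triangles of $G$ such that (1) no four triangles of $\mathscr{T}$ are the four triangles of a $K_4$ in $G$, and (2) every two-coloring of $E(G)$ has a monochromatic triangle in $\mathscr{T}$. *)

theory Defs
  imports Complex_Main "HOL-Computational_Algebra.Primes" "HOL-Algebra.Ring"
begin

definition is_prime_power :: "nat \<Rightarrow> bool" where
  "is_prime_power q \<longleftrightarrow> (\<exists>p k. prime p \<and> k \<ge> 1 \<and> q = p ^ k)"

definition nzvecs :: "('a, 'b) ring_scheme \<Rightarrow> ('a \<times> 'a \<times> 'a) set" where
  "nzvecs R = {(x, y, z). x \<in> carrier R \<and> y \<in> carrier R \<and> z \<in> carrier R \<and>
                  \<not> (x = \<zero>\<^bsub>R\<^esub> \<and> y = \<zero>\<^bsub>R\<^esub> \<and> z = \<zero>\<^bsub>R\<^esub>)}"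

definition pspan :: "('a, 'b) ring_scheme \<Rightarrow> 'a \<times> 'a \<times> 'a \<Rightarrow> ('a \<times> 'a \<times> 'a) set" where
  "pspan R v = (case v of (x, y, z) \<Rightarrow>
     {(c \<otimes>\<^bsub>R\<^esub> x, c \<otimes>\<^bsub>R\<^esub> y, c \<otimes>\<^bsub>R\<^esub> z) | c. c \<in> carrier R \<and> c \<noteq> \<zero>\<^bsub>R\<^esub>})"

definition ppoints :: "('a, 'b) ring_scheme \<Rightarrow> ('a \<times> 'a \<times> 'a) set set" where
  "ppoints R = pspan R ` nzvecs R"

definition pline :: "('a, 'b) ring_scheme \<Rightarrow> 'a \<times> 'a \<times> 'a \<Rightarrow> ('a \<times> 'a \<times> 'a) set set" where
  "pline R l = (case l of (a, b, c) \<Rightarrow>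
     {pspan R (x, y, z) | x y z. (x, y, z) \<in> nzvecs R \<and>
        (a \<otimes>\<^bsub>R\<^esub> x) \<oplus>\<^bsub>R\<^esub> (b \<otimes>\<^bsub>R\<^esub> y) \<oplus>\<^bsub>R\<^esub> (c \<otimes>\<^bsub>R\<^esub> z) = \<zero>\<^bsub>R\<^esub>})"

definition plines :: "('a, 'b) ring_scheme \<Rightarrow> ('a \<times> 'a \<times> 'a) set set set" where
  "plines R = pline R ` nzvecs R"

section \<open>Hermitian unital in PG(2,q^2) and its secants\<close>

definition hunital :: "('a, 'b) ring_scheme \<Rightarrow> nat \<Rightarrow> ('a \<times> 'a \<times> 'a) set set" where
  "hunital R q = {pspan R (x, y, z) | x y z. (x, y, z) \<in> nzvecs R \<and>
      (x [^]\<^bsub>R\<^esub> (q + 1)) \<oplus>\<^bsub>R\<^esub> (y [^]\<^bsub>R\<^esub> (q + 1)) \<oplus>\<^bsub>R\<^esub> (z [^]\<^bsub>R\<^esub> (q + 1)) = \<zero>\<^bsub>R\<^esub>}"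

definition secants :: "('a, 'b) ring_scheme \<Rightarrow> nat \<Rightarrow> ('a \<times> 'a \<times> 'a) set set set" where
  "secants R q = {l \<in> plines R. card (l \<inter> hunital R q) = q + 1}"

definition meet :: "('a \<times> 'a \<times> 'a) set set \<Rightarrow> ('a \<times> 'a \<times> 'a) set set \<Rightarrow> ('a \<times> 'a \<times> 'a) set" where
  "meet l1 l2 = the_elem (l1 \<inter> l2)"

text \<open>Adjacency of the graph H_q (on vertex set secants R q).\<close>
definition Hadj :: "('a, 'b) ring_scheme \<Rightarrow> nat \<Rightarrow> ('a \<times> 'a \<times> 'a) set set \<Rightarrow> ('a \<times> 'a \<times> 'a) set set \<Rightarrow> bool" where
  "Hadj R q l1 l2 \<longleftrightarrow> l1 \<noteq> l2 \<and> meet l1 l2 \<in> hunital R q"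

definition Htri :: "('a, 'b) ring_scheme \<Rightarrow> nat \<Rightarrow> ('a \<times> 'a \<times> 'a) set set set set" where
  "Htri R q = {{l1, l2, l3} | l1 l2 l3.
      l1 \<in> secants R q \<and> l2 \<in> secants R q \<and> l3 \<in> secants R q \<and>
      Hadj R q l1 l2 \<and> Hadj R q l2 l3 \<and> Hadj R q l1 l3 \<and>
      meet l1 l2 \<noteq> meet l2 l3 \<and> meet l1 l2 \<noteq> meet l1 l3 \<and> meet l2 l3 \<noteq> meet l1 l3}"

section \<open>Generic graph notions (graph = vertex set V with symmetric irreflexive adjacency adj)\<close>

definition is_triangle :: "'v set \<Rightarrow> ('v \<Rightarrow> 'v \<Rightarrow> bool) \<Rightarrow> 'v set \<Rightarrow> bool" where
  "is_triangle V adj t \<longleftrightarrow> (\<exists>a b c. t = {a, b, c} \<and> a \<in> V \<and> b \<in> V \<and> c \<in> V \<and>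
      adj a b \<and> adj b c \<and> adj a c \<and> a \<noteq> b \<and> b \<noteq> c \<and> a \<noteq> c)"

text \<open>A two-colouring of the edges is a function from 2-element vertex sets to bool;
  only its values on edges matter. A triangle is monochromatic if all its edges get the same colour.\<close>
definition monochromatic :: "('v set \<Rightarrow> bool) \<Rightarrow> 'v set \<Rightarrow> bool" where
  "monochromatic col t \<longleftrightarrow> (\<exists>c. \<forall>a\<in>t. \<forall>b\<in>t. a \<noteq> b \<longrightarrow> col {a, b} = c)"

definition quasi_folkman_with :: "'v set \<Rightarrow> ('v \<Rightarrow> 'v \<Rightarrow> bool) \<Rightarrow> 'v set set \<Rightarrow> bool" where
  "quasi_folkman_with V adj T \<longleftrightarrow>
     (\<forall>t\<in>T. is_triangle V adj t) \<and>
     \<not> (\<exists>a b c d. a \<in> V \<and> b \<in> V \<and> c \<in> V \<and> d \<in> V \<and> distinct [a, b, c, d] \<and>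
          adj a b \<and> adj a c \<and> adj a d \<and> adj b c \<and> adj b d \<and> adj c d \<and>
          {a, b, c} \<in> T \<and> {a, b, d} \<in> T \<and> {a, c, d} \<in> T \<and> {b, c, d} \<in> T) \<and>
     (\<forall>col :: 'v set \<Rightarrow> bool. \<exists>t\<in>T. monochromatic col t)"

end

theory Submission
  imports Defs "HOL-Algebra.Multiplicative_Group"
begin

text \<open>
  The points of the unital with the secants as blocks form a \<open>2-(q\<^sup>3 + 1, q + 1, 1)\<close> design, and this alone
  gives the Ramsey statement. Fix a secant \<open>l\<close> and a point \<open>X\<close> of the unital off \<open>l\<close>: the \<open>q + 1\<close> secants
  joining \<open>X\<close> to \<open>l\<close> span, in pairs, the non-degenerate triangles with side \<open>l\<close> and opposite vertex
  \<open>X\<close>, and at most \<open>(q + 1)\<^sup>2 / 4\<close> of these \<open>q (q + 1) / 2\<close> pairs have differently coloured edges to \<open>l\<close>.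
  A non-monochromatic triangle has exactly two sides at which its two edges differ in colour, a triangle has three
  sides, so the proportion of non-monochromatic triangles is at most \<open>3 (q + 1) / (4 q)\<close>.

  Four non-degenerate triangles on a \<open>K\<^sub>4\<close> would be an O'Nan configuration: four secants meeting in
  six distinct points of the unital. Scale isotropic vectors \<open>u\<^sub>1, u\<^sub>2, u\<^sub>3\<close> spanning the vertices of
  the triangle cut out by three of the secants so that the fourth one meets the sides in the spans of
  \<open>u\<^sub>i - u\<^sub>j\<close>. Isotropy of the differences makes the \<open>3 \<times> 3\<close> Gram matrix alternating,
  hence singular, although the form is non-degenerate.
\<close>

section \<open>Triangles in a unital\<close>

lemma triple_eq_cases:
  assumes "{a, b, c} = {l, m, n}" "l \<noteq> m" "m \<noteq> n" "l \<noteq> n"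
  shows "(a, b, c) \<in> {(l, m, n), (l, n, m), (m, l, n), (m, n, l), (n, l, m), (n, m, l)}"
proof -
  have "a \<in> {l, m, n}" "b \<in> {l, m, n}" "c \<in> {l, m, n}" "l \<in> {a, b, c}" "m \<in> {a, b, c}" "n \<in> {a, b, c}"
    using assms(1) by blast+
  with assms(2-4) show ?thesis
    unfolding insert_iff empty_iff prod.inject by metis
qed

text \<open>Members of \<open>L\<close> are whole lines, which may have points outside
  \<open>U\<close>; the blocks of the design are the traces \<open>l \<inter> U\<close>. Accordingly
  \<open>meet_unique\<close> concerns arbitrary common points, not only those in
  \<open>U\<close>.\<close>

locale unital =
  fixes U :: "'p set" and L :: "'p set set" and q :: nat
  assumes finite_L: "finite L"
    and card_U: "card U = q ^ 3 + 1"
    and q_ge_2: "q \<ge> 2"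
    and card_block: "l \<in> L \<Longrightarrow> card (l \<inter> U) = q + 1"
    and joined: "x \<in> U \<Longrightarrow> y \<in> U \<Longrightarrow> x \<noteq> y \<Longrightarrow> \<exists>l\<in>L. x \<in> l \<and> y \<in> l"
    and meet_unique: "l \<in> L \<Longrightarrow> m \<in> L \<Longrightarrow> l \<noteq> m \<Longrightarrow> x \<in> l \<Longrightarrow> x \<in> m \<Longrightarrow> y \<in> l \<Longrightarrow> y \<in> m \<Longrightarrow> x = y"
begin

section \<open>Number of blocks of the design\<close>

lemma finite_U: "finite U"
  using card_U by (auto intro: card_ge_0_finite)

text \<open>Double counting of ordered pairs of distinct points of \<open>U\<close>: every pair lies
  in exactly one block, and every block contains (q + 1) q of them.\<close>

lemma card_L: "card L = q ^ 4 - q ^ 3 + q ^ 2"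
proof -
  let ?S = "\<lambda>A. (A \<times> A) - (\<lambda>x. (x, x)) ` A"
  have card_S: "card (?S A) = card A * (card A - 1)" if "finite A" for A :: "'p set"
  proof -
    have "card (?S A) = card (A \<times> A) - card ((\<lambda>x. (x, x)) ` A)"
      using that by (intro card_Diff_subset) auto
    also have "card ((\<lambda>x. (x, x)) ` A) = card A"
      by (intro card_image) (auto simp: inj_on_def)
    finally show ?thesis by (simp add: card_cartesian_product algebra_simps)
  qed
  have "?S U = (\<Union>l\<in>L. ?S (l \<inter> U))"
  proof (intro equalityI subsetI)
    fix z assume "z \<in> ?S U"
    then obtain x y where "z = (x, y)" "x \<in> U" "y \<in> U" "x \<noteq> y" by auto
    then show "z \<in> (\<Union>l\<in>L. ?S (l \<inter> U))" using joined[of x y] by auto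
  qed auto
  also have "card \<dots> = (\<Sum>l\<in>L. card (?S (l \<inter> U)))"
  proof (intro card_UN_disjoint ballI impI)
    fix l m assume *: "l \<in> L" "m \<in> L" "l \<noteq> m"
    show "?S (l \<inter> U) \<inter> ?S (m \<inter> U) = {}"
      using meet_unique[OF *] by blast
  qed (use finite_L finite_U in auto)
  also have "\<dots> = (\<Sum>l\<in>L. (q + 1) * q)"
    using card_S card_block finite_U by (intro sum.cong) auto
  finally have eq: "(q ^ 3 + 1) * q ^ 3 = card L * ((q + 1) * q)"
    using card_S[OF finite_U] card_U by simp
  have "(q ^ 3 + 1) * q ^ 3 = (q ^ 4 - q ^ 3 + q ^ 2) * ((q + 1) * q)"
  proof -
    have "q ^ 3 \<le> q ^ 4" using q_ge_2 by (intro power_increasing) auto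
    \<comment> \<open>The polynomial identity is checked over the integers, where subtraction is not
      truncated.\<close>
    then have "int ((q ^ 4 - q ^ 3 + q ^ 2) * ((q + 1) * q)) = int ((q ^ 3 + 1) * q ^ 3)"
      by (simp add: of_nat_diff algebra_simps power2_eq_square power3_eq_cube power4_eq_xxxx)
    then show ?thesis by linarith
  qed
  with eq have "card L * ((q + 1) * q) = (q ^ 4 - q ^ 3 + q ^ 2) * ((q + 1) * q)"
    by simp
  then show ?thesis
    using q_ge_2 by (simp only: mult_cancel2) auto
qed

section \<open>Non-degenerate triangles and the pencils that generate them\<close>

definition proper_triangle :: "'p set \<Rightarrow> 'p set \<Rightarrow> 'p set \<Rightarrow> bool" where
  "proper_triangle l m n \<longleftrightarrow> l \<in> L \<and> m \<in> L \<and> n \<in> L \<and> l \<noteq> m \<and> m \<noteq> n \<and> l \<noteq> n \<and>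
     (\<exists>A\<in>U \<inter> l \<inter> m. \<exists>B\<in>U \<inter> m \<inter> n. \<exists>C\<in>U \<inter> l \<inter> n. A \<noteq> B \<and> B \<noteq> C \<and> A \<noteq> C)"

definition proper_triangles :: "'p set set set" where
  "proper_triangles = {{l, m, n} | l m n. proper_triangle l m n}"

definition pencil :: "'p set \<Rightarrow> 'p \<Rightarrow> 'p set set" where
  "pencil l X = {m \<in> L. X \<in> m \<and> (\<exists>A\<in>U. A \<in> l \<and> A \<in> m)}"

lemma proper_triangle_swap:
  assumes "proper_triangle l m n"
  shows "proper_triangle m l n" "proper_triangle l n m"
proof -
  obtain A B C where *: "A \<in> U \<inter> l \<inter> m" "B \<in> U \<inter> m \<inter> n" "C \<in> U \<inter> l \<inter> n"
    "A \<noteq> B" "B \<noteq> C" "A \<noteq> C" "l \<in> L" "m \<in> L" "n \<in> L" "l \<noteq> m" "m \<noteq> n" "l \<noteq> n"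
    using assms unfolding proper_triangle_def by blast
  show "proper_triangle m l n"
    unfolding proper_triangle_def
    by (intro conjI bexI[of _ A] bexI[of _ B] bexI[of _ C]) (use * in simp_all)
  show "proper_triangle l n m"
    unfolding proper_triangle_def
    by (intro conjI bexI[of _ A] bexI[of _ B] bexI[of _ C]) (use * in simp_all)
qed

text \<open>The two transpositions of \<open>proper_triangle_swap\<close> generate all permutations
  of the sides, so whichever ordering witnesses membership of the unordered set, the given ordering
  is a triangle too.\<close>

lemma proper_triangle_of_mem:
  assumes "{a, b, c} \<in> proper_triangles"
  shows "proper_triangle a b c"
proof -
  have "\<exists>l m n. {a, b, c} = {l, m, n} \<and> proper_triangle l m n"
    using assms by (simp only: proper_triangles_def mem_Collect_eq)
  then obtain l m n where eq: "{a, b, c} = {l, m, n}" and t: "proper_triangle l m n"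
    by (elim exE conjE)
  then have ne: "l \<noteq> m" "m \<noteq> n" "l \<noteq> n" by (simp_all add: proper_triangle_def)
  note s1 = proper_triangle_swap(1) and s2 = proper_triangle_swap(2)
  show ?thesis
    using triple_eq_cases[OF eq ne] t s1[OF t] s2[OF t] s2[OF s1[OF t]] s1[OF s2[OF t]] s1[OF s2[OF s1[OF t]]]
    by (elim insertE) (simp_all only: prod.inject empty_iff)
qed

lemma finite_proper_triangles: "finite proper_triangles"
proof (rule finite_subset)
  show "proper_triangles \<subseteq> Pow L"
    unfolding proper_triangles_def proper_triangle_def by blast
qed (use finite_L in simp)

lemma finite_pencil: "finite (pencil l X)"
  using finite_L by (auto simp: pencil_def)

text \<open>Joining \<open>X\<close> to the q + 1 points of \<open>l \<inter> U\<close> is a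
  bijection onto the pencil: a join containing two points of \<open>l\<close> would be
  \<open>l\<close> itself, which misses \<open>X\<close>.\<close>

lemma card_pencil:
  assumes "l \<in> L" "X \<in> U" "X \<notin> l"
  shows "card (pencil l X) = q + 1"
proof -
  have "\<exists>m\<in>L. X \<in> m \<and> A \<in> m" if "A \<in> l \<inter> U" for A
    using joined[of X A] assms that by auto
  then obtain j where j: "\<And>A. A \<in> l \<inter> U \<Longrightarrow> j A \<in> L \<and> X \<in> j A \<and> A \<in> j A"
    by metis
  have "bij_betw j (l \<inter> U) (pencil l X)"
    unfolding bij_betw_def
  proof (intro conjI equalityI subsetI)
    show "inj_on j (l \<inter> U)"
    proof (rule inj_onI)
      fix A B assume "A \<in> l \<inter> U" "B \<in> l \<inter> U" "j A = j B"
      then show "A = B"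
        using meet_unique[of l "j A" A B] j[of A] j[of B] assms by auto
    qed
  next
    fix m assume "m \<in> pencil l X"
    then obtain A where "m \<in> L" "X \<in> m" "A \<in> U" "A \<in> l" "A \<in> m"
      by (auto simp: pencil_def)
    moreover from this have "m = j A"
      using meet_unique[of m "j A" X A] j[of A] assms by auto
    ultimately show "m \<in> j ` (l \<inter> U)" by auto
  qed (use j in \<open>auto simp: pencil_def\<close>)
  then show ?thesis
    using card_block[OF assms(1)] bij_betw_same_card by fastforce
qed

text \<open>The two further sides of a triangle with side \<open>l\<close> are two members of the pencil
  spanned by \<open>l\<close> and the opposite vertex, and this vertex can be recovered from them.\<close>

lemma triangles_through_bij:
  assumes l: "l \<in> L"
  shows "bij_betw (\<lambda>(X, p). insert l p)
           (SIGMA X:U - l. {p. p \<subseteq> pencil l X \<and> card p = 2}) {t \<in> proper_triangles. l \<in> t}"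
  unfolding bij_betw_def
proof (intro conjI equalityI subsetI)
  have notin: "l \<notin> p" if "X \<in> U - l" "p \<subseteq> pencil l X" for X p
    using that by (auto simp: pencil_def)
  show "inj_on (\<lambda>(X, p). insert l p) (SIGMA X:U - l. {p. p \<subseteq> pencil l X \<and> card p = 2})"
  proof (rule inj_onI, clarify)
    fix X p Y r assume *: "X \<in> U" "X \<notin> l" "p \<subseteq> pencil l X" "card p = 2"
       "Y \<in> U" "Y \<notin> l" "r \<subseteq> pencil l Y" "card r = 2" "insert l p = insert l r"
    have "l \<notin> p" "l \<notin> r"
      using notin[of X p] notin[of Y r] * by simp_all
    then have "p = r"
      using \<open>insert l p = insert l r\<close> by (metis Diff_insert_absorb)
    moreover obtain m n where "p = {m, n}" "m \<noteq> n"
      using * by (meson card_2_iff)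
    ultimately have "X = Y"
      using * meet_unique[of m n X Y] by (auto simp: pencil_def)
    with \<open>p = r\<close> show "X = Y \<and> p = r" by simp
  qed
next
  fix t assume "t \<in> (\<lambda>(X, p). insert l p) ` (SIGMA X:U - l. {p. p \<subseteq> pencil l X \<and> card p = 2})"
  then obtain X p where X: "X \<in> U" "X \<notin> l" and p: "p \<subseteq> pencil l X" "card p = 2" and t: "t = insert l p"
    by auto
  then obtain m n where mn: "p = {m, n}" "m \<noteq> n"
    by (meson card_2_iff)
  with p obtain A B where AB: "m \<in> L" "n \<in> L" "X \<in> m" "X \<in> n" "A \<in> U" "A \<in> l" "A \<in> m" "B \<in> U" "B \<in> l" "B \<in> n"
    by (auto simp: pencil_def)
  have "A \<noteq> B"
    using meet_unique[of m n A X] AB X mn by auto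
  moreover have "A \<noteq> X" "X \<noteq> B" "l \<noteq> m" "l \<noteq> n"
    using AB X by blast+
  ultimately have "proper_triangle l m n"
    unfolding proper_triangle_def
    by (intro conjI bexI[of _ A] bexI[of _ X] bexI[of _ B]) (simp_all add: AB X l mn)
  then show "t \<in> {t \<in> proper_triangles. l \<in> t}"
    unfolding proper_triangles_def t mn by blast
next
  fix t assume "t \<in> {t \<in> proper_triangles. l \<in> t}"
  then obtain a b c where "t = {a, b, c}" "l \<in> {a, b, c}" "proper_triangle a b c"
    unfolding proper_triangles_def by blast
  then obtain m n where t: "t = {l, m, n}" and mn: "proper_triangle l m n"
  proof -
    consider "l = a" | "l = b" | "l = c" using \<open>l \<in> {a, b, c}\<close> by blast
    then show ?thesis
    proof cases
      case 1 then show ?thesis using that[of b c] \<open>t = _\<close> \<open>proper_triangle a b c\<close> by simp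
    next
      case 2 then show ?thesis
        using that[of a c] \<open>t = _\<close> proper_triangle_swap(1)[OF \<open>proper_triangle a b c\<close>]
        by (simp add: insert_commute)
    next
      case 3
      have "proper_triangle c a b"
        by (rule proper_triangle_swap(1)[OF proper_triangle_swap(2)[OF \<open>proper_triangle a b c\<close>]])
      then show ?thesis using 3 that[of a b] \<open>t = _\<close> by (simp add: insert_commute)
    qed
  qed
  then obtain A B C where ABC: "A \<in> U" "A \<in> l" "A \<in> m" "B \<in> U" "B \<in> m" "B \<in> n" "C \<in> U" "C \<in> l" "C \<in> n"
    "A \<noteq> B" "B \<noteq> C" "A \<noteq> C" "m \<in> L" "n \<in> L" "l \<noteq> m" "m \<noteq> n"
    unfolding proper_triangle_def by blast
  then have "B \<notin> l"
    using meet_unique[of l m A B] l by auto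
  moreover have "{m, n} \<subseteq> pencil l B" "card {m, n} = 2"
    using ABC by (auto simp: pencil_def simp del: set_eq_iff)
  ultimately show "t \<in> (\<lambda>(X, p). insert l p) ` (SIGMA X:U - l. {p. p \<subseteq> pencil l X \<and> card p = 2})"
    using ABC t by (intro image_eqI[of _ _ "(B, {m, n})"]) auto
qed

lemma card_Diff_block:
  assumes "l \<in> L"
  shows "card (U - l) = q ^ 3 - q"
proof -
  have "card (U - l) = card U - card (U \<inter> l)"
    by (rule card_Diff_subset_Int) (simp add: finite_U)
  then show ?thesis
    using card_block[OF assms] card_U by (simp add: Int_commute)
qed

text \<open>Each of the q^3 - q points of \<open>U\<close> off \<open>l\<close> is opposite to
  \<open>l\<close> in one triangle for every pair from its pencil. The count is doubled to keep it
  free of division.\<close>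

lemma card_triangles_through:
  assumes l: "l \<in> L"
  shows "2 * card {t \<in> proper_triangles. l \<in> t} = (q ^ 3 - q) * (q * (q + 1))"
proof -
  have "card {t \<in> proper_triangles. l \<in> t} =
      card (SIGMA X:U - l. {p. p \<subseteq> pencil l X \<and> card p = 2})"
    using bij_betw_same_card[OF triangles_through_bij[OF l]] by simp
  also have "\<dots> = (\<Sum>X\<in>U - l. card {p. p \<subseteq> pencil l X \<and> card p = 2})"
    using finite_U finite_pencil by (intro card_SigmaI) auto
  also have "\<dots> = (\<Sum>X\<in>U - l. (q + 1) choose 2)"
    using card_pencil[OF l] by (intro sum.cong) (auto simp: n_subsets[OF finite_pencil])
  also have "\<dots> = (q ^ 3 - q) * ((q + 1) choose 2)"
    using card_Diff_block[OF l] by simp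
  finally have "2 * card {t \<in> proper_triangles. l \<in> t} = (q ^ 3 - q) * (2 * ((q + 1) choose 2))"
    by simp
  also have "2 * ((q + 1) choose 2) = q * (q + 1)"
    by (simp add: choose_two)
  finally show ?thesis .
qed

section \<open>Colour changes at the sides of a triangle and the Ramsey count\<close>

definition bichromatic_at :: "('p set set \<Rightarrow> bool) \<Rightarrow> 'p set \<Rightarrow> 'p set set \<Rightarrow> bool" where
  "bichromatic_at col l t \<longleftrightarrow> (\<exists>m\<in>t - {l}. \<exists>n\<in>t - {l}. col {l, m} \<noteq> col {l, n})"

text \<open>A side \<open>l\<close> is a vertex of the graph, and \<open>bichromatic_at\<close> says
  that the two edges of the graph triangle at this vertex differ in colour. For each opposite point
  \<open>X\<close> the colour of the edge to \<open>l\<close> splits the pencil into parts of sizes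
  a and b with a + b = q + 1, and the bichromatic pairs number ab, at most (q + 1)^2 / 4.\<close>

lemma card_bichromatic_at:
  assumes l: "l \<in> L"
  shows "4 * card {t \<in> proper_triangles. l \<in> t \<and> bichromatic_at col l t} \<le> (q ^ 3 - q) * (q + 1)\<^sup>2"
proof -
  let ?P = "\<lambda>X. {m \<in> pencil l X. col {l, m}}" and ?N = "\<lambda>X. {m \<in> pencil l X. \<not> col {l, m}}"
  let ?S = "SIGMA X:U - l. ?P X \<times> ?N X"
  have "{t \<in> proper_triangles. l \<in> t \<and> bichromatic_at col l t} \<subseteq> (\<lambda>(X, m, n). {l, m, n}) ` ?S"
  proof (intro subsetI, elim CollectE conjE)
    fix t assume "t \<in> proper_triangles" "l \<in> t" and bi: "bichromatic_at col l t"
    then obtain X p where X: "X \<in> U - l" and p: "p \<subseteq> pencil l X" "card p = 2" and t: "t = insert l p"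
    proof -
      have "t \<in> (\<lambda>(X, p). insert l p) ` (SIGMA X:U - l. {p. p \<subseteq> pencil l X \<and> card p = 2})"
        using bij_betw_imp_surj_on[OF triangles_through_bij[OF l]] \<open>t \<in> proper_triangles\<close> \<open>l \<in> t\<close> by simp
      then show ?thesis using that by auto
    qed
    obtain m n where m: "m \<in> t - {l}" "col {l, m}" and n: "n \<in> t - {l}" "\<not> col {l, n}"
      using bi unfolding bichromatic_at_def by blast
    then have "p = {m, n}"
      using p t by (metis (no_types, lifting) Diff_iff card_2_iff doubleton_eq_iff insert_iff)
    then show "t \<in> (\<lambda>(X, m, n). {l, m, n}) ` ?S"
      using m n t p X by (intro image_eqI[of _ _ "(X, m, n)"]) auto
  qed
  moreover have finite_S: "finite ?S"
    using finite_U finite_pencil by auto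
  ultimately have "card {t \<in> proper_triangles. l \<in> t \<and> bichromatic_at col l t} \<le> card ?S"
    by (rule surj_card_le[rotated])
  also have "\<dots> = (\<Sum>X\<in>U - l. card (?P X) * card (?N X))"
    using finite_U finite_pencil by (subst card_SigmaI) (auto simp: card_cartesian_product)
  finally have "4 * card {t \<in> proper_triangles. l \<in> t \<and> bichromatic_at col l t} \<le>
      (\<Sum>X\<in>U - l. 4 * (card (?P X) * card (?N X)))"
    by (simp only: sum_distrib_left[symmetric] mult_le_mono2)
  also have "\<dots> \<le> (\<Sum>X\<in>U - l. (q + 1)\<^sup>2)"
  proof (rule sum_mono)
    fix X assume X: "X \<in> U - l"
    have "card (?P X \<union> ?N X) = card (?P X) + card (?N X)"
      using finite_pencil by (intro card_Un_disjoint) auto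
    moreover have "?P X \<union> ?N X = pencil l X" by auto
    ultimately have sum_eq: "card (?P X) + card (?N X) = q + 1"
      using card_pencil[OF l] X by simp
    have am_gm: "4 * (a * b) \<le> (a + b)\<^sup>2" for a b :: nat
    proof -
      have "0 \<le> (int a - int b)\<^sup>2" by simp
      then have "int (4 * (a * b)) \<le> int ((a + b)\<^sup>2)"
        by (simp add: power2_eq_square algebra_simps)
      then show ?thesis by linarith
    qed
    show "4 * (card (?P X) * card (?N X)) \<le> (q + 1)\<^sup>2"
      using am_gm[of "card (?P X)" "card (?N X)"] by (simp only: sum_eq)
  qed
  also have "\<dots> = (q ^ 3 - q) * (q + 1)\<^sup>2"
    using card_Diff_block[OF l] by simp
  finally show ?thesis .
qed

text \<open>Double counting of incident pairs of a side and a triangle. It is applied with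
  \<open>Q\<close> constantly true to count all triangles, and with \<open>bichromatic_at\<close> to
  count colour changes.\<close>

lemma sum_over_sides:
  "(\<Sum>l\<in>L. card {t \<in> proper_triangles. l \<in> t \<and> Q l t}) = (\<Sum>t\<in>proper_triangles. card {l \<in> t. Q l t})"
proof -
  have "(\<Sum>l\<in>L. card {t \<in> proper_triangles. l \<in> t \<and> Q l t}) =
      (\<Sum>l\<in>L. \<Sum>t | t \<in> proper_triangles \<and> l \<in> t \<and> Q l t. 1)"
    by simp
  also have "\<dots> = (\<Sum>t\<in>proper_triangles. \<Sum>l | l \<in> L \<and> l \<in> t \<and> Q l t. 1)"
    using finite_L finite_proper_triangles by (rule sum.swap_restrict)
  also have "\<dots> = (\<Sum>t\<in>proper_triangles. card {l \<in> t. Q l t})"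
  proof (rule sum.cong)
    fix t assume "t \<in> proper_triangles"
    then have "t \<subseteq> L" unfolding proper_triangles_def proper_triangle_def by blast
    then have "{l. l \<in> L \<and> l \<in> t \<and> Q l t} = {l \<in> t. Q l t}" by auto
    then show "(\<Sum>l | l \<in> L \<and> l \<in> t \<and> Q l t. 1) = card {l \<in> t. Q l t}" by simp
  qed simp
  finally show ?thesis .
qed

text \<open>The factor 6 is the doubling in \<open>card_triangles_through\<close> times the three
  sides of a triangle.\<close>

lemma card_triangles: "6 * card proper_triangles = card L * ((q ^ 3 - q) * (q * (q + 1)))"
proof -
  have "card {l \<in> t. True} = 3" if "t \<in> proper_triangles" for t
  proof -
    obtain l m n where "t = {l, m, n}" "proper_triangle l m n"
      using \<open>t \<in> proper_triangles\<close> unfolding proper_triangles_def by blast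
    moreover have "{x \<in> t. True} = t" by simp
    ultimately show ?thesis by (simp add: proper_triangle_def)
  qed
  then have "6 * card proper_triangles = 2 * (\<Sum>t\<in>proper_triangles. card {l \<in> t. True})"
    by simp
  also have "\<dots> = (\<Sum>l\<in>L. 2 * card {t \<in> proper_triangles. l \<in> t})"
    using sum_over_sides[of "\<lambda>_ _. True"] by (simp flip: sum_distrib_left)
  also have "\<dots> = card L * ((q ^ 3 - q) * (q * (q + 1)))"
    using card_triangles_through by simp
  finally show ?thesis .
qed

text \<open>If three edges in two colours are not all alike, one of them differs from the other two,
  and both its ends see a change of colour.\<close>

lemma bichromatic_at_two_sides:
  assumes "t \<in> proper_triangles" "\<not> monochromatic col t"
  shows "2 \<le> card {l \<in> t. bichromatic_at col l t}"
proof -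
  obtain a b c where t: "t = {a, b, c}" and d: "a \<noteq> b" "b \<noteq> c" "a \<noteq> c"
    using assms(1) unfolding proper_triangles_def proper_triangle_def by blast
  have "t - {a} = {b, c}" "t - {b} = {a, c}" "t - {c} = {a, b}"
    using d t by auto
  then have bi: "bichromatic_at col a t \<longleftrightarrow> col {a, b} \<noteq> col {a, c}"
    "bichromatic_at col b t \<longleftrightarrow> col {a, b} \<noteq> col {b, c}"
    "bichromatic_at col c t \<longleftrightarrow> col {a, c} \<noteq> col {b, c}"
    unfolding bichromatic_at_def by (auto simp: insert_commute)
  have "\<not> (col {a, b} = col {a, c} \<and> col {a, c} = col {b, c})"
    using assms(2) d unfolding monochromatic_def t by (auto simp: insert_commute)
  then have "\<exists>x y. x \<noteq> y \<and> {x, y} \<subseteq> {l \<in> t. bichromatic_at col l t}"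
    using bi d t by (cases "col {a, b}"; cases "col {a, c}"; cases "col {b, c}") auto
  then obtain x y where "x \<noteq> y" "{x, y} \<subseteq> {l \<in> t. bichromatic_at col l t}" by blast
  moreover have "finite t" using t by simp
  ultimately show ?thesis
    using card_mono[of "{l \<in> t. bichromatic_at col l t}" "{x, y}"] by simp
qed

text \<open>Division-free form of the bound that the proportion of monochromatic triangles is at
  least (q - 3) / (4q).\<close>

theorem card_monochromatic:
  "4 * q * card {t \<in> proper_triangles. monochromatic col t} + 3 * card proper_triangles \<ge> q * card proper_triangles"
proof -
  let ?B = "{t \<in> proper_triangles. \<not> monochromatic col t}"
  let ?M = "{t \<in> proper_triangles. monochromatic col t}"
  have "2 * card ?B = (\<Sum>t\<in>?B. 2)" by simp
  also have "\<dots> \<le> (\<Sum>t\<in>?B. card {l \<in> t. bichromatic_at col l t})"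
    by (rule sum_mono) (use bichromatic_at_two_sides in auto)
  also have "\<dots> \<le> (\<Sum>t\<in>proper_triangles. card {l \<in> t. bichromatic_at col l t})"
    by (rule sum_mono2) (use finite_proper_triangles in auto)
  also have "\<dots> = (\<Sum>l\<in>L. card {t \<in> proper_triangles. l \<in> t \<and> bichromatic_at col l t})"
    by (rule sum_over_sides[symmetric])
  finally have "8 * card ?B \<le> (\<Sum>l\<in>L. 4 * card {t \<in> proper_triangles. l \<in> t \<and> bichromatic_at col l t})"
    by (simp add: sum_distrib_left[symmetric])
  also have "\<dots> \<le> (\<Sum>l\<in>L. (q ^ 3 - q) * (q + 1)\<^sup>2)"
    by (rule sum_mono) (rule card_bichromatic_at)
  finally have "8 * card ?B \<le> card L * ((q ^ 3 - q) * (q + 1)\<^sup>2)" by simp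
  \<comment> \<open>Multiplying by \<open>q\<close> makes the right-hand side q + 1 times the
    expression for six times the number of triangles in \<open>card_triangles\<close>.\<close>
  then have "q * (8 * card ?B) \<le> q * (card L * ((q ^ 3 - q) * (q + 1)\<^sup>2))" by simp
  also have "\<dots> = (q + 1) * (card L * ((q ^ 3 - q) * (q * (q + 1))))"
    by (simp only: power2_eq_square ac_simps)
  also have "\<dots> = (q + 1) * (6 * card proper_triangles)"
    using card_triangles by simp
  finally have bad: "4 * (q * card ?B) \<le> 3 * (q * card proper_triangles) + 3 * card proper_triangles"
    by simp
  have "card (?M \<union> ?B) = card ?M + card ?B"
    using finite_proper_triangles by (intro card_Un_disjoint) auto
  moreover have "?M \<union> ?B = proper_triangles" by auto
  ultimately have "card proper_triangles = card ?M + card ?B" by simp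
  then have "4 * (q * card proper_triangles) = 4 * (q * card ?M) + 4 * (q * card ?B)"
    by (simp add: algebra_simps)
  with bad show ?thesis by simp
qed

text \<open>Needed to make the comparison of 3 and q strict after multiplying both by the number of
  triangles.\<close>

lemma card_triangles_pos: "card proper_triangles > 0"
proof -
  have "q < q ^ 3"
    using q_ge_2 power_strict_increasing[of 1 3 q] by simp
  moreover have "card L > 0" using q_ge_2 card_L by (metis add_gr_0 gr0I not_numeral_le_zero zero_less_power)
  ultimately show ?thesis
    using card_triangles q_ge_2 by (intro gr0I) auto
qed

end

section \<open>Frobenius and power maps in finite fields\<close>

lemma (in cring) binomial_ring:
  assumes [simp]: "x \<in> carrier R" "y \<in> carrier R"
  shows "(x \<oplus> y) [^] n = (\<Oplus>k\<in>{..n}. [(n choose k)] \<cdot> (x [^] k \<otimes> y [^] (n - k)))"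
proof (induction n)
  case 0
  then show ?case by (simp add: add.nat_pow_eone)
next
  case (Suc n)
  let ?t = "\<lambda>k. x [^] k \<otimes> y [^] (n - k)" and ?s = "\<lambda>k. x [^] Suc k \<otimes> y [^] (n - k)"
  have Y: "(\<Oplus>k\<in>{..n}. [(n choose k)] \<cdot> ?t k) \<otimes> y =
      (\<Oplus>k\<in>{..n}. [(n choose Suc k)] \<cdot> ?s k) \<oplus> y [^] Suc n"
  proof -
    have "(\<Oplus>k\<in>{..n}. [(n choose k)] \<cdot> ?t k) \<otimes> y =
        (\<Oplus>k\<in>{..n}. [(n choose k)] \<cdot> (x [^] k \<otimes> y [^] (Suc n - k)))"
      by (subst finsum_ldistr) (auto intro!: finsum_cong' simp: add_pow_ldistr m_assoc Suc_diff_le)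
    \<comment> \<open>The new top term has coefficient \<open>n choose Suc n\<close>, which is 0.
      Splitting off index 0 next shifts the sum by one, so that it has the same monomials
      \<open>?s k\<close> as the product with \<open>x\<close> and Pascal's rule applies.\<close>
    also have "\<dots> = (\<Oplus>k\<in>{..Suc n}. [(n choose k)] \<cdot> (x [^] k \<otimes> y [^] (Suc n - k)))"
      by (subst finsum_Suc) (auto intro!: finsum_closed simp: binomial_eq_0)
    also have "\<dots> = (\<Oplus>k\<in>{..n}. [(n choose Suc k)] \<cdot> ?s k) \<oplus> y [^] Suc n"
      by (subst finsum_Suc2) auto
    finally show ?thesis .
  qed
  have X: "(\<Oplus>k\<in>{..n}. [(n choose k)] \<cdot> ?t k) \<otimes> x = (\<Oplus>k\<in>{..n}. [(n choose k)] \<cdot> ?s k)"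
    by (subst finsum_ldistr) (auto intro!: finsum_cong' simp: add_pow_rdistr m_ac)
  have "(x \<oplus> y) [^] Suc n = (\<Oplus>k\<in>{..n}. [(n choose k)] \<cdot> ?t k) \<otimes> (x \<oplus> y)"
    by (simp add: Suc)
  also have "\<dots> = (\<Oplus>k\<in>{..n}. [(n choose k)] \<cdot> ?t k) \<otimes> x \<oplus> (\<Oplus>k\<in>{..n}. [(n choose k)] \<cdot> ?t k) \<otimes> y"
    by (intro r_distr) (auto intro!: finsum_closed)
  also have "\<dots> = ((\<Oplus>k\<in>{..n}. [(n choose k)] \<cdot> ?s k) \<oplus> (\<Oplus>k\<in>{..n}. [(n choose Suc k)] \<cdot> ?s k)) \<oplus> y [^] Suc n"
    unfolding X Y by (intro a_assoc[symmetric]) (auto intro!: finsum_closed)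
  also have "(\<Oplus>k\<in>{..n}. [(n choose k)] \<cdot> ?s k) \<oplus> (\<Oplus>k\<in>{..n}. [(n choose Suc k)] \<cdot> ?s k) =
      (\<Oplus>k\<in>{..n}. [(n choose k)] \<cdot> ?s k \<oplus> [(n choose Suc k)] \<cdot> ?s k)"
    by (intro finsum_addf[symmetric]) auto
  also have "\<dots> = (\<Oplus>k\<in>{..n}. [(Suc n choose Suc k)] \<cdot> ?s k)"
    by (intro finsum_cong') (auto simp: add.nat_pow_mult)
  also have "\<dots> \<oplus> y [^] Suc n = (\<Oplus>k\<in>{..Suc n}. [(Suc n choose k)] \<cdot> (x [^] k \<otimes> y [^] (Suc n - k)))"
    by (subst finsum_Suc2) auto
  finally show ?case .
qed

text \<open>The prime \<open>p\<close> divides \<open>p choose k\<close> for 0 < k < p and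
  annihilates the ring, so only the two extreme terms of the binomial expansion survive.\<close>

lemma (in cring) add_pow_prime_char:
  fixes p :: nat
  assumes p: "prime p" and char: "[p] \<cdot> \<one> = \<zero>" and [simp]: "x \<in> carrier R" "y \<in> carrier R"
  shows "(x \<oplus> y) [^] p = x [^] p \<oplus> y [^] p"
proof -
  have p1: "p > 1" using p by (rule prime_gt_1_nat)
  \<comment> \<open>With this form of \<open>p\<close> the indices strictly between 0 and
    \<open>p\<close> are exactly \<open>Suc k\<close> for k \<le> m.\<close>
  then obtain m where m: "p = Suc (Suc m)"
    by (metis One_nat_def Suc_lessE less_imp_Suc_add add_0)
  have ann: "[n] \<cdot> z = \<zero>" if "p dvd n" "z \<in> carrier R" for n z
  proof -
    have "[p] \<cdot> z = \<zero>"
      using add_pow_ldistr[of \<one> z p] char that by simp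
    then show ?thesis
      using that by (auto simp: dvd_def add.nat_pow_pow[symmetric] )
  qed
  let ?f = "\<lambda>k. [(p choose k)] \<cdot> (x [^] k \<otimes> y [^] (p - k))"
  have "(x \<oplus> y) [^] p = (\<Oplus>k\<in>{..Suc (Suc m)}. ?f k)"
    using binomial_ring[of x y p] m by simp
  also have "\<dots> = ?f p \<oplus> (\<Oplus>k\<in>{..Suc m}. ?f k)"
    by (subst finsum_Suc) (auto simp: m)
  also have "(\<Oplus>k\<in>{..Suc m}. ?f k) = (\<Oplus>k\<in>{..m}. ?f (Suc k)) \<oplus> ?f 0"
    by (subst finsum_Suc2) auto
  also have "(\<Oplus>k\<in>{..m}. ?f (Suc k)) = (\<Oplus>k\<in>{..m}. \<zero>)"
  proof (intro finsum_cong')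
    fix k assume "k \<in> {..m}"
    then show "?f (Suc k) = \<zero>"
      using p m by (intro ann dvd_choose_prime) auto
  qed auto
  finally show ?thesis by (simp add: add.nat_pow_eone)
qed

lemma (in cring) add_pow_prime_power_char:
  fixes p :: nat
  assumes "prime p" "[p] \<cdot> \<one> = \<zero>" "x \<in> carrier R" "y \<in> carrier R"
  shows "(x \<oplus> y) [^] (p ^ k) = x [^] (p ^ k) \<oplus> y [^] (p ^ k)"
proof (induction k)
  case (Suc k)
  have "(x \<oplus> y) [^] (p ^ Suc k) = ((x \<oplus> y) [^] (p ^ k)) [^] p"
    using assms by (simp add: nat_pow_pow mult.commute)
  also have "\<dots> = (x [^] (p ^ k)) [^] p \<oplus> (y [^] (p ^ k)) [^] p"
    using assms Suc by (simp add: add_pow_prime_char)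
  finally show ?case
    using assms by (simp add: nat_pow_pow mult.commute)
qed (use assms in auto)

section \<open>Characteristic and fibres of power maps in a finite field\<close>

lemma (in domain) nat_pow_eq_zero_iff:
  assumes "x \<in> carrier R" "n > 0"
  shows "x [^] (n::nat) = \<zero> \<longleftrightarrow> x = \<zero>"
proof -
  have "x [^] k \<noteq> \<zero>" if "x \<noteq> \<zero>" for k :: nat
    using that assms(1) by (induction k) (auto simp: integral_iff)
  then show ?thesis using assms nat_pow_zero by auto
qed

text \<open>Lagrange's theorem in the additive group makes the \<open>p ^ n\<close>-fold multiple of
  1 vanish. This multiple is the n-th power of the \<open>p\<close>-fold one, and a field has no
  nonzero nilpotents.\<close>

lemma (in field) prime_char_of_card:
  assumes "finite (carrier R)" "card (carrier R) = p ^ n"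
  shows "[p] \<cdot> \<one> = \<zero>"
proof -
  have "[(p ^ n)] \<cdot> \<one> = \<zero>"
    using add.pow_order_eq_1[of \<one>] assms by (simp add: order_def)
  moreover have "[(p ^ k)] \<cdot> \<one> = ([p] \<cdot> \<one>) [^] k" for k
  proof (induction k)
    case (Suc k)
    have "[(p ^ Suc k)] \<cdot> \<one> = [p] \<cdot> ([(p ^ k)] \<cdot> \<one>)"
      by (simp add: add.nat_pow_pow mult.commute)
    also have "\<dots> = ([(p ^ k)] \<cdot> \<one>) \<otimes> ([p] \<cdot> \<one>)"
      using add_pow_rdistr[of "[(p ^ k)] \<cdot> \<one>" \<one> p] by simp
    finally show ?case using Suc by simp
  qed simp
  ultimately have "([p] \<cdot> \<one>) [^] n = \<zero>" by simp
  then show ?thesis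
    using nat_pow_eq_zero_iff[of "[p] \<cdot> \<one>" n] by (cases n) auto
qed

text \<open>Each fibre of \<open>x \<mapsto> x\<^sup>e\<close> has at most \<open>e\<close> elements, and the image lies in the set of \<open>d\<close>-th
  roots of unity; since \<open>d * e\<close> is the number of nonzero elements, equality holds everywhere.\<close>

lemma (in field) card_nth_roots:
  assumes fin: "finite (carrier R)" and de: "card (carrier R) - 1 = d * e"
    and y: "y \<in> carrier R" "y [^] d = \<one>"
  shows "card {x \<in> carrier R. x [^] e = y} = e"
proof -
  let ?G = "carrier R - {\<zero>}" and ?D = "{y \<in> carrier R. y [^] d = \<one>}"
  let ?F = "\<lambda>y. {x \<in> carrier R. x [^] e = y}"
  have cardG: "card ?G = d * e" using fin de by simp
  have "card {\<zero>, \<one>} \<le> card (carrier R)"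
    using fin by (intro card_mono) auto
  then have de0: "d > 0" "e > 0" using de by (auto intro: gr0I)
  have Dnz: "y \<noteq> \<zero>" if "y \<in> ?D" for y
    using that de0 by (auto simp: nat_pow_zero)
  have im: "x [^] e \<in> ?D" if "x \<in> ?G" for x
  proof -
    interpret G: group "mult_of R" by (rule field_mult_group)
    have "x [^] (d * e) = \<one>"
      using G.pow_order_eq_1[of x] that cardG by (simp add: order_def nat_pow_mult_of)
    then show ?thesis using that by (simp add: nat_pow_pow mult.commute)
  qed
  have le: "card (?F y) \<le> e" if y: "y \<in> ?D" for y
  proof (cases "?F y = {}")
    case False
    then obtain z where z: "z \<in> carrier R" "z [^] e = y" by auto
    have znz: "z \<noteq> \<zero>" using z Dnz[OF y] de0 by (auto simp: nat_pow_zero)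
    then have u: "z \<in> Units R" using z field_Units by auto
    \<comment> \<open>Division by one element \<open>z\<close> of the fibre embeds it into the
      \<open>e\<close>-th roots of unity, whose number is bounded by the degree of the
      polynomial.\<close>
    have "(\<lambda>x. x \<otimes> inv z) ` ?F y \<subseteq> {x \<in> carrier R. x [^] e = \<one>}"
    proof (rule image_subsetI)
      fix x assume "x \<in> ?F y"
      then have x: "x \<in> carrier R" "x [^] e = z [^] e" using z by auto
      have "(x \<otimes> inv z) [^] e = x [^] e \<otimes> (inv z) [^] e"
        using x u by (simp add: nat_pow_distrib)
      also have "\<dots> = (z \<otimes> inv z) [^] e"
        using x u by (metis Units_closed Units_inv_closed nat_pow_distrib)
      finally show "x \<otimes> inv z \<in> {x \<in> carrier R. x [^] e = \<one>}"
        using x u by (simp add: Units_closed)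
    qed
    moreover have "inj_on (\<lambda>x. x \<otimes> inv z) (?F y)"
    proof (rule inj_onI)
      fix a b assume *: "a \<in> ?F y" "b \<in> ?F y" "a \<otimes> inv z = b \<otimes> inv z"
      have "x \<otimes> inv z \<otimes> z = x" if "x \<in> carrier R" for x
        using u that by (simp add: m_assoc Units_closed)
      with * show "a = b" by (metis (mono_tags, lifting) mem_Collect_eq)
    qed
    ultimately have "card (?F y) \<le> card {x \<in> carrier R. x [^] e = \<one>}"
      using fin by (intro card_inj_on_le[of "\<lambda>x. x \<otimes> inv z"]) auto
    also have "\<dots> \<le> e" using num_roots_le_deg[OF fin, of e] de0 by simp
    finally show ?thesis .
  next
    case True
    then show ?thesis by (simp only: card.empty)
  qed
  have Dfin: "finite ?D" using fin by simp
  have "?G = (\<Union>y\<in>?D. ?F y)"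
  proof (intro equalityI subsetI)
    fix x assume "x \<in> ?G"
    then show "x \<in> (\<Union>y\<in>?D. ?F y)" using im[of x] by blast
  next
    fix x assume "x \<in> (\<Union>y\<in>?D. ?F y)"
    then have "x \<in> carrier R" "x [^] e \<in> ?D" by auto
    then show "x \<in> ?G" using Dnz[of "x [^] e"] de0 by (auto simp: nat_pow_zero)
  qed
  then have "d * e = card (\<Union>y\<in>?D. ?F y)" using cardG by simp
  also have "\<dots> = (\<Sum>y\<in>?D. card (?F y))"
    using fin by (intro card_UN_disjoint) auto
  finally have tot: "d * e = (\<Sum>y\<in>?D. card (?F y))" .
  show ?thesis
  proof (rule ccontr)
    assume "\<not> ?thesis"
    then have "card (?F y) < e" using le[of y] y by simp
    then have "(\<Sum>y\<in>?D. card (?F y)) < (\<Sum>y\<in>?D. e)"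
      using y le Dfin by (intro sum_strict_mono_ex1) auto
    also have "\<dots> = card ?D * e" by simp
    also have "\<dots> \<le> d * e" using num_roots_le_deg[OF fin, of d] de0 by simp
    finally show False using tot by simp
  qed
qed

section \<open>The projective plane over a field\<close>

context ring
begin

definition vecs :: "('a \<times> 'a \<times> 'a) set" where
  "vecs = carrier R \<times> carrier R \<times> carrier R"

abbreviation vzero :: "'a \<times> 'a \<times> 'a" where
  "vzero \<equiv> (\<zero>, \<zero>, \<zero>)"

fun vscale :: "'a \<Rightarrow> 'a \<times> 'a \<times> 'a \<Rightarrow> 'a \<times> 'a \<times> 'a" where
  "vscale c (x, y, z) = (c \<otimes> x, c \<otimes> y, c \<otimes> z)"

fun vadd :: "'a \<times> 'a \<times> 'a \<Rightarrow> 'a \<times> 'a \<times> 'a \<Rightarrow> 'a \<times> 'a \<times> 'a" where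
  "vadd (a, b, c) (x, y, z) = (a \<oplus> x, b \<oplus> y, c \<oplus> z)"

fun vdot :: "'a \<times> 'a \<times> 'a \<Rightarrow> 'a \<times> 'a \<times> 'a \<Rightarrow> 'a" where
  "vdot (a, b, c) (x, y, z) = a \<otimes> x \<oplus> b \<otimes> y \<oplus> c \<otimes> z"

fun vcross :: "'a \<times> 'a \<times> 'a \<Rightarrow> 'a \<times> 'a \<times> 'a \<Rightarrow> 'a \<times> 'a \<times> 'a" where
  "vcross (a, b, c) (x, y, z) =
     (b \<otimes> z \<ominus> c \<otimes> y, c \<otimes> x \<ominus> a \<otimes> z, a \<otimes> y \<ominus> b \<otimes> x)"

lemma vecs_iff [simp]: "(x, y, z) \<in> vecs \<longleftrightarrow> x \<in> carrier R \<and> y \<in> carrier R \<and> z \<in> carrier R"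
  by (simp add: vecs_def)

lemma nzvecs_eq: "nzvecs R = vecs - {vzero}"
  by (auto simp: nzvecs_def vecs_def)

lemma vec_closed [simp]:
  "u \<in> vecs \<Longrightarrow> c \<in> carrier R \<Longrightarrow> vscale c u \<in> vecs"
  "u \<in> vecs \<Longrightarrow> v \<in> vecs \<Longrightarrow> vadd u v \<in> vecs"
  "u \<in> vecs \<Longrightarrow> v \<in> vecs \<Longrightarrow> vdot u v \<in> carrier R"
  "u \<in> vecs \<Longrightarrow> v \<in> vecs \<Longrightarrow> vcross u v \<in> vecs"
  by (cases u; cases v; simp)+

lemma pspan_eq: "pspan R v = {vscale c v | c. c \<in> carrier R \<and> c \<noteq> \<zero>}"
  by (cases v) (simp add: pspan_def)

end

context cring
begin

lemma vdot_commute: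
  "u \<in> vecs \<Longrightarrow> v \<in> vecs \<Longrightarrow> vdot u v = vdot v u"
  by (cases u; cases v) (simp add: m_comm)

lemma vdot_linear [simp]:
  "u \<in> vecs \<Longrightarrow> v \<in> vecs \<Longrightarrow> w \<in> vecs \<Longrightarrow> vdot w (vadd u v) = vdot w u \<oplus> vdot w v"
  "u \<in> vecs \<Longrightarrow> v \<in> vecs \<Longrightarrow> w \<in> vecs \<Longrightarrow> vdot (vadd u v) w = vdot u w \<oplus> vdot v w"
  "u \<in> vecs \<Longrightarrow> w \<in> vecs \<Longrightarrow> c \<in> carrier R \<Longrightarrow> vdot w (vscale c u) = c \<otimes> vdot w u"
  "u \<in> vecs \<Longrightarrow> w \<in> vecs \<Longrightarrow> c \<in> carrier R \<Longrightarrow> vdot (vscale c u) w = c \<otimes> vdot u w"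
  "u \<in> vecs \<Longrightarrow> vdot vzero u = \<zero>" "u \<in> vecs \<Longrightarrow> vdot u vzero = \<zero>"
  by (cases u; cases v; cases w; simp; algebra)+

lemma vdot_vcross:
  assumes "u \<in> vecs" "v \<in> vecs"
  shows "vdot (vcross u v) u = \<zero>" "vdot (vcross u v) v = \<zero>"
  using assms by (cases u; cases v; simp; algebra)+

lemma vcross_antisym:
  assumes "u \<in> vecs" "v \<in> vecs"
  shows "vcross u v = vscale (\<ominus> \<one>) (vcross v u)"
  using assms by (cases u; cases v; simp add: l_minus; algebra)

lemma vcross_linear:
  assumes "u \<in> vecs" "v \<in> vecs" "w \<in> vecs" "c \<in> carrier R"
  shows "vcross (vadd u v) w = vadd (vcross u w) (vcross v w)"
    "vcross (vscale c u) w = vscale c (vcross u w)"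
  using assms
  by (cases u; cases v; cases w; simp; algebra)+

text \<open>Expansion of the vector triple product. It turns orthogonality of \<open>w\<close> to
  both \<open>u\<close> and \<open>v\<close> into parallelism of \<open>w\<close> and
  \<open>vcross u v\<close>.\<close>

lemma vcross_vcross:
  assumes "u \<in> vecs" "v \<in> vecs" "w \<in> vecs"
  shows "vcross w (vcross u v) = vadd (vscale (vdot w v) u) (vscale (\<ominus> vdot w u) v)"
  using assms
  by (cases u; cases v; cases w; simp; algebra)

lemma vector_space_simps:
  "u \<in> vecs \<Longrightarrow> c \<in> carrier R \<Longrightarrow> d \<in> carrier R \<Longrightarrow> vscale c (vscale d u) = vscale (c \<otimes> d) u"
  "u \<in> vecs \<Longrightarrow> vscale \<one> u = u"
  "u \<in> vecs \<Longrightarrow> vscale \<zero> u = vzero"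
  "c \<in> carrier R \<Longrightarrow> vscale c vzero = vzero"
  "u \<in> vecs \<Longrightarrow> vadd vzero u = u"
  "u \<in> vecs \<Longrightarrow> vadd u vzero = u"
  "u \<in> vecs \<Longrightarrow> v \<in> vecs \<Longrightarrow> c \<in> carrier R \<Longrightarrow> vscale c (vadd u v) = vadd (vscale c u) (vscale c v)"
  "u \<in> vecs \<Longrightarrow> c \<in> carrier R \<Longrightarrow> d \<in> carrier R \<Longrightarrow> vscale (c \<oplus> d) u = vadd (vscale c u) (vscale d u)"
  by (cases u; cases v; simp; algebra)+

end

context field
begin

lemma vscale_eq_vzero_iff:
  assumes "u \<in> vecs" "c \<in> carrier R"
  shows "vscale c u = vzero \<longleftrightarrow> c = \<zero> \<or> u = vzero"
  using assms by (cases u) (auto simp: integral_iff)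

lemma vscale_inverse:
  assumes "c \<in> carrier R" "c \<noteq> \<zero>" "u \<in> vecs"
  shows "inv c \<in> carrier R" "inv c \<noteq> \<zero>" "vscale (inv c) (vscale c u) = u" "vscale c (vscale (inv c) u) = u"
proof -
  have c: "c \<in> Units R" using assms field_Units by auto
  then show i: "inv c \<in> carrier R" by simp
  show "inv c \<noteq> \<zero>" using c assms(1) by (metis Units_r_inv r_null zero_not_one)
  show "vscale (inv c) (vscale c u) = u" "vscale c (vscale (inv c) u) = u"
    using c i assms by (simp_all add: vector_space_simps)
qed

text \<open>At a position where \<open>v\<close> is nonzero, the quotient of the two coordinates is
  the required scalar; the vanishing 2 x 2 minors make it fit the other positions. The scalar is 0
  when \<open>u\<close> is.\<close>

lemma vcross_eq_vzeroD:
  assumes "u \<in> vecs" "v \<in> vecs" "v \<noteq> vzero" "vcross u v = vzero"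
  obtains c where "c \<in> carrier R" "u = vscale c v"
proof -
  obtain a b c x y z where uv: "u = (a, b, c)" "v = (x, y, z)"
    by (metis prod_cases3)
  have car [simp]: "a \<in> carrier R" "b \<in> carrier R" "c \<in> carrier R" "x \<in> carrier R" "y \<in> carrier R" "z \<in> carrier R"
    using assms uv by auto
  have eq: "b \<otimes> z = c \<otimes> y" "c \<otimes> x = a \<otimes> z" "a \<otimes> y = b \<otimes> x"
    using assms(4) uv by auto
  have ratio: "s' = s \<otimes> inv t \<otimes> t'"
    if "s \<in> carrier R" "t \<in> carrier R" "t \<noteq> \<zero>" "s' \<in> carrier R" "t' \<in> carrier R" "s \<otimes> t' = s' \<otimes> t"
    for s t s' t'
  proof -
    have t: "t \<in> Units R" using that field_Units by auto
    have "s \<otimes> inv t \<otimes> t' = (s \<otimes> t') \<otimes> inv t"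
      using that(1,2,5) t by (simp add: m_ac)
    also have "\<dots> = s' \<otimes> t \<otimes> inv t" using that by simp
    also have "\<dots> = s'" using that(2,4) t by (simp add: m_assoc)
    finally show ?thesis by simp
  qed
  have inv_closed: "inv t \<in> carrier R" if "t \<in> carrier R" "t \<noteq> \<zero>" for t
    using that field_Units by auto
  consider "x \<noteq> \<zero>" | "y \<noteq> \<zero>" | "z \<noteq> \<zero>" using assms(3) uv by auto
  then show ?thesis
  proof cases
    case 1
    have "u = vscale (a \<otimes> inv x) v"
      unfolding uv vscale.simps prod.inject by (intro conjI ratio) (simp_all add: 1 eq)
    from that[OF _ this] show ?thesis using inv_closed 1 by simp
  next
    case 2
    have "u = vscale (b \<otimes> inv y) v"
      unfolding uv vscale.simps prod.inject by (intro conjI ratio) (simp_all add: 2 eq)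
    from that[OF _ this] show ?thesis using inv_closed 2 by simp
  next
    case 3
    have "u = vscale (c \<otimes> inv z) v"
      unfolding uv vscale.simps prod.inject by (intro conjI ratio) (simp_all add: 3 eq)
    from that[OF _ this] show ?thesis using inv_closed 3 by simp
  qed
qed

section \<open>Points and lines in homogeneous coordinates\<close>

lemma pspan_eqI:
  assumes "u \<in> vecs" "c \<in> carrier R" "c \<noteq> \<zero>"
  shows "pspan R (vscale c u) = pspan R u"
proof (intro equalityI subsetI)
  fix x assume "x \<in> pspan R (vscale c u)"
  then obtain d where d: "d \<in> carrier R" "d \<noteq> \<zero>" "x = vscale d (vscale c u)"
    by (auto simp: pspan_eq)
  then show "x \<in> pspan R u"
    using assms unfolding pspan_eq
    by (intro CollectI exI[of _ "d \<otimes> c"]) (simp add: vector_space_simps integral_iff)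
next
  fix x assume "x \<in> pspan R u"
  then obtain d where d: "d \<in> carrier R" "d \<noteq> \<zero>" "x = vscale d u"
    by (auto simp: pspan_eq)
  note i = vscale_inverse[OF assms(2,3,1)]
  have "x = vscale d (vscale (inv c) (vscale c u))"
    using d i by simp
  also have "\<dots> = vscale (d \<otimes> inv c) (vscale c u)"
    using d i assms by (intro vector_space_simps) auto
  finally show "x \<in> pspan R (vscale c u)"
    using d i unfolding pspan_eq
    by (intro CollectI exI[of _ "d \<otimes> inv c"]) (simp add: integral_iff)
qed

lemma pspan_self: "u \<in> vecs \<Longrightarrow> u \<in> pspan R u"
  unfolding pspan_eq by (intro CollectI exI[of _ \<one>]) (simp add: vector_space_simps)

lemma pspan_eqD:
  assumes "u \<in> vecs" "v \<in> vecs" "pspan R u = pspan R v"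
  obtains c where "c \<in> carrier R" "c \<noteq> \<zero>" "u = vscale c v"
  using pspan_self[OF assms(1)] assms(3) by (auto simp: pspan_eq)

lemma pspan_eq_of_vscale:
  assumes "u \<in> nzvecs R" "v \<in> vecs" "c \<in> carrier R" "u = vscale c v"
  shows "pspan R u = pspan R v"
  using assms pspan_eqI[of v c] vscale_eq_vzero_iff[of v c] by (auto simp: nzvecs_eq)

text \<open>Whether a dot product vanishes does not depend on the vector chosen to represent the
  point.\<close>

lemma mem_pline_iff:
  assumes "l \<in> vecs" "u \<in> nzvecs R"
  shows "pspan R u \<in> pline R l \<longleftrightarrow> vdot l u = \<zero>"
proof
  assume "vdot l u = \<zero>"
  with assms show "pspan R u \<in> pline R l"
    by (cases u; cases l) (auto simp: pline_def)
next
  assume "pspan R u \<in> pline R l"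
  then obtain v where v: "v \<in> nzvecs R" "vdot l v = \<zero>" "pspan R u = pspan R v"
    by (cases l) (auto simp: pline_def)
  then obtain c where "c \<in> carrier R" "u = vscale c v"
    using pspan_eqD[of u v] assms by (auto simp: nzvecs_eq)
  then show "vdot l u = \<zero>"
    using v assms by (simp add: nzvecs_eq)
qed

lemma mem_plineE:
  assumes "P \<in> pline R l"
  obtains u where "u \<in> nzvecs R" "P = pspan R u"
  using assms by (cases l) (auto simp: pline_def)

lemma vcross_nonzero:
  assumes "u \<in> nzvecs R" "v \<in> nzvecs R" "pspan R u \<noteq> pspan R v"
  shows "vcross u v \<in> nzvecs R"
  using assms vcross_eq_vzeroD[of u v] pspan_eq_of_vscale[of u v] unfolding nzvecs_eq
  by (metis DiffD1 DiffD2 DiffI singletonD singletonI vec_closed(4))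

text \<open>By the triple product expansion \<open>l\<close> has zero cross product with
  \<open>vcross u v\<close>, which is itself nonzero because the two spans differ.\<close>

lemma perp_unique:
  assumes uv: "u \<in> nzvecs R" "v \<in> nzvecs R" "pspan R u \<noteq> pspan R v"
    and l: "l \<in> vecs" "vdot l u = \<zero>" "vdot l v = \<zero>"
  obtains c where "c \<in> carrier R" "l = vscale c (vcross u v)"
proof -
  have "vcross l (vcross u v) = vzero"
    using uv l by (simp add: nzvecs_eq vcross_vcross vector_space_simps)
  then show ?thesis
    using vcross_eq_vzeroD[of l "vcross u v"] vcross_nonzero[OF uv] l that uv
    by (auto simp: nzvecs_eq)
qed

text \<open>Serves in two dual readings: \<open>u\<close>, \<open>v\<close> as points and
  \<open>l\<close>, \<open>m\<close> as lines through them, or \<open>u\<close>, \<open>v\<close> as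
  lines and \<open>l\<close>, \<open>m\<close> as common points. The same duality lets
  \<open>plines_joined\<close> supply the meet of two lines.\<close>

lemma perp_pspan_unique:
  assumes "u \<in> nzvecs R" "v \<in> nzvecs R" "pspan R u \<noteq> pspan R v"
    and "l \<in> nzvecs R" "vdot l u = \<zero>" "vdot l v = \<zero>"
    and "m \<in> nzvecs R" "vdot m u = \<zero>" "vdot m v = \<zero>"
  shows "pspan R l = pspan R m"
proof -
  have "pspan R k = pspan R (vcross u v)" if "k \<in> nzvecs R" "vdot k u = \<zero>" "vdot k v = \<zero>" for k
    using perp_unique[OF assms(1-3), of k] that vcross_nonzero[OF assms(1-3)]
      pspan_eq_of_vscale[of k "vcross u v"] by (auto simp: nzvecs_eq)
  with assms show ?thesis by metis
qed

lemma pline_eqI: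
  assumes "l \<in> nzvecs R" "m \<in> nzvecs R" "pspan R l = pspan R m"
  shows "pline R l = pline R m"
proof -
  obtain c where c: "c \<in> carrier R" "c \<noteq> \<zero>" "l = vscale c m"
    using pspan_eqD[of l m] assms by (auto simp: nzvecs_eq)
  have "P \<in> pline R l \<longleftrightarrow> P \<in> pline R m" if "P = pspan R u" "u \<in> nzvecs R" for P u
    using that assms c by (simp add: mem_pline_iff nzvecs_eq integral_iff)
  then show ?thesis
    by (metis mem_plineE subsetI equalityI)
qed

lemma plines_joined:
  assumes "u \<in> nzvecs R" "v \<in> nzvecs R" "pspan R u \<noteq> pspan R v"
  obtains l where "l \<in> nzvecs R" "vdot l u = \<zero>" "vdot l v = \<zero>"
proof -
  have "u \<in> vecs" "v \<in> vecs" using assms by (simp_all add: nzvecs_eq)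
  from that[OF vcross_nonzero[OF assms] vdot_vcross[OF this]] show ?thesis .
qed

lemma plines_meet:
  assumes "l \<in> plines R" "m \<in> plines R" "l \<noteq> m"
  obtains P where "l \<inter> m = {P}"
proof -
  obtain a b where ab: "a \<in> nzvecs R" "b \<in> nzvecs R" "l = pline R a" "m = pline R b"
    using assms unfolding plines_def by blast
  then have ne: "pspan R a \<noteq> pspan R b" using assms pline_eqI by blast
  obtain u where u: "u \<in> nzvecs R" "vdot u a = \<zero>" "vdot u b = \<zero>"
    using plines_joined[OF ab(1,2) ne] by blast
  have "l \<inter> m = {pspan R u}"
  proof (intro equalityI subsetI)
    fix P assume P: "P \<in> l \<inter> m"
    then obtain v where v: "v \<in> nzvecs R" "P = pspan R v" using ab mem_plineE by blast
    then have "vdot v a = \<zero>" "vdot v b = \<zero>"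
      using P ab mem_pline_iff vdot_commute by (auto simp: nzvecs_eq)
    then show "P \<in> {pspan R u}"
      using perp_pspan_unique[OF ab(1,2) ne, of v u] u v by simp
  next
    fix P assume "P \<in> {pspan R u}"
    then show "P \<in> l \<inter> m"
      using u ab mem_pline_iff vdot_commute by (auto simp: nzvecs_eq)
  qed
  then show ?thesis using that by blast
qed

text \<open>For \<open>y\<close> on the line, \<open>vcross y u\<close> is a multiple of
  \<open>l\<close>. If the factors for \<open>x\<close> and \<open>v\<close> are \<open>k\<close>
  and \<open>k'\<close>, then k' is nonzero, and subtracting (k / k') v from \<open>x\<close> leaves
  a vector parallel to \<open>u\<close>.\<close>

lemma on_line_span:
  assumes uv: "u \<in> nzvecs R" "v \<in> nzvecs R" "pspan R u \<noteq> pspan R v"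
    and l: "l \<in> nzvecs R" "vdot l u = \<zero>" "vdot l v = \<zero>"
    and x: "x \<in> vecs" "vdot l x = \<zero>"
  obtains a b where "a \<in> carrier R" "b \<in> carrier R" "x = vadd (vscale a u) (vscale b v)"
proof -
  have car: "u \<in> vecs" "v \<in> vecs" "l \<in> vecs" "u \<noteq> vzero" "l \<noteq> vzero" using uv l by (auto simp: nzvecs_eq)
  have par: "\<exists>k\<in>carrier R. vcross y u = vscale k l" if "y \<in> vecs" "vdot l y = \<zero>" for y
  proof -
    have "vcross l (vcross y u) = vzero"
      using that car l by (simp add: vcross_vcross vector_space_simps)
    then have "vcross (vcross y u) l = vzero"
      using that car vcross_antisym[of "vcross y u" l] by (simp add: vector_space_simps)
    then show ?thesis
      using vcross_eq_vzeroD[of "vcross y u" l] that car by (metis vec_closed(4))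
  qed
  obtain k where k: "k \<in> carrier R" "vcross x u = vscale k l" using par x by blast
  obtain k' where k': "k' \<in> carrier R" "vcross v u = vscale k' l" using par car l by blast
  have "k' \<noteq> \<zero>"
    using vcross_nonzero[OF uv(2,1)] uv(3) k' car by (auto simp: nzvecs_eq vector_space_simps)
  then have u': "k' \<in> Units R" using k' field_Units by auto
  define t where "t = k \<otimes> inv k'"
  have t: "t \<in> carrier R" "t \<otimes> k' = k" using k u' k' by (auto simp: t_def m_assoc)
  have "vcross (vadd x (vscale (\<ominus> t) v)) u = vadd (vscale k l) (vscale (\<ominus> t) (vscale k' l))"
    using k k' car x t by (simp add: vcross_linear)
  also have "\<dots> = vscale (k \<ominus> t \<otimes> k') l"
    using k k' car t by (simp add: vector_space_simps(1) a_minus_def vector_space_simps(8) l_minus)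
  also have "k \<ominus> t \<otimes> k' = \<zero>" using k t by simp
  also have "vscale \<zero> l = vzero" using car by (simp add: vector_space_simps(3))
  finally obtain a where a: "a \<in> carrier R" "vadd x (vscale (\<ominus> t) v) = vscale a u"
    using vcross_eq_vzeroD[of "vadd x (vscale (\<ominus> t) v)" u] car x t
    by (metis a_inv_closed vec_closed(1) vec_closed(2))
  have "x = vadd (vadd x (vscale (\<ominus> t) v)) (vscale t v)"
    using x t car by (cases x; cases v) (simp; algebra)
  then show ?thesis using that[of a t] a t by simp
qed

end

section \<open>The Hermitian unital\<close>

locale hermitian_plane = field R for R (structure) +
  fixes q :: nat
  assumes finite_carrier: "finite (carrier R)"
    and card_carrier: "card (carrier R) = q ^ 2"
    and prime_power: "is_prime_power q"
begin

lemma q_ge_2: "q \<ge> 2"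
proof -
  obtain p k where "prime p" "k \<ge> 1" "q = p ^ k"
    using prime_power by (auto simp: is_prime_power_def)
  then show ?thesis
    using prime_ge_2_nat[of p] self_le_power[of p k] by auto
qed

section \<open>Conjugation, the involutory field automorphism raising to the power
  \<open>q\<close>\<close>

definition bar :: "'a \<Rightarrow> 'a" where
  "bar x = x [^] q"

lemma bar_closed [simp]: "x \<in> carrier R \<Longrightarrow> bar x \<in> carrier R"
  by (simp add: bar_def)

lemma bar_add [simp]:
  assumes "x \<in> carrier R" "y \<in> carrier R"
  shows "bar (x \<oplus> y) = bar x \<oplus> bar y"
proof -
  obtain p k where pk: "prime p" "q = p ^ k"
    using prime_power by (auto simp: is_prime_power_def)
  then have "card (carrier R) = p ^ (k * 2)" using card_carrier by (simp add: power_mult)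
  then have "[p] \<cdot> \<one> = \<zero>" using prime_char_of_card finite_carrier by blast
  then show ?thesis
    unfolding bar_def using add_pow_prime_power_char[OF pk(1)] assms pk(2) by simp
qed

lemma bar_mult [simp]:
  "x \<in> carrier R \<Longrightarrow> y \<in> carrier R \<Longrightarrow> bar (x \<otimes> y) = bar x \<otimes> bar y"
  by (simp add: bar_def nat_pow_distrib)

lemma bar_zero [simp]: "bar \<zero> = \<zero>"
  using q_ge_2 by (simp add: bar_def nat_pow_zero)

lemma bar_minus [simp]:
  assumes "x \<in> carrier R"
  shows "bar (\<ominus> x) = \<ominus> bar x"
proof (rule minus_equality[symmetric])
  have "bar (\<ominus> x) \<oplus> bar x = bar (\<ominus> x \<oplus> x)" using assms by simp
  then show "bar (\<ominus> x) \<oplus> bar x = \<zero>" using assms by (simp add: l_neg)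
qed (use assms in auto)

lemma bar_eq_zero_iff [simp]: "x \<in> carrier R \<Longrightarrow> bar x = \<zero> \<longleftrightarrow> x = \<zero>"
  using q_ge_2 by (simp add: bar_def nat_pow_eq_zero_iff)

text \<open>By Lagrange's theorem in the multiplicative group of order q^2 - 1, every nonzero
  \<open>x\<close> satisfies x^(q^2) = x.\<close>

lemma bar_bar [simp]:
  assumes "x \<in> carrier R"
  shows "bar (bar x) = x"
proof (cases "x = \<zero>")
  case False
  interpret G: group "mult_of R" by (rule field_mult_group)
  have "x [^] (q ^ 2 - 1) = \<one>"
    using G.pow_order_eq_1[of x] False assms finite_carrier card_carrier
    by (simp add: order_def nat_pow_mult_of)
  then have "x [^] Suc (q ^ 2 - 1) = x" using assms by simp
  also have "Suc (q ^ 2 - 1) = q * q" using q_ge_2 by (simp add: power2_eq_square)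
  finally show ?thesis using assms by (simp add: bar_def nat_pow_pow)
qed simp

section \<open>Norm fibres and trace kernel over the subfield of order \<open>q\<close>\<close>

lemma norm_eq: "x \<in> carrier R \<Longrightarrow> x [^] (q + 1) = x \<otimes> bar x"
  by (simp add: bar_def m_comm)

text \<open>The two orders of the factors prepare the two uses of \<open>card_nth_roots\<close>:
  exponent q + 1 for the norm and exponent q - 1 for the trace.\<close>

lemma card_factor: "card (carrier R) - 1 = (q - 1) * (q + 1)" "card (carrier R) - 1 = (q + 1) * (q - 1)"
proof -
  obtain r where "q = Suc r" using q_ge_2 by (cases q) auto
  then show "card (carrier R) - 1 = (q - 1) * (q + 1)" "card (carrier R) - 1 = (q + 1) * (q - 1)"
    by (simp_all add: card_carrier power2_eq_square)
qed

lemma bar_pow: "x \<in> carrier R \<Longrightarrow> bar x = x [^] (q - 1) \<otimes> x"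
  using q_ge_2 nat_pow_Suc[of x "q - 1"] by (simp add: bar_def)

text \<open>The condition \<open>bar b = b\<close> gives b^(q - 1) = 1 for nonzero \<open>b\<close>,
  so the root count for the exponent q + 1 applies. Over 0 there is only 0.\<close>

lemma card_norm_fibre:
  assumes "b \<in> carrier R" "bar b = b"
  shows "card {z \<in> carrier R. z [^] (q + 1) = b} = (if b = \<zero> then 1 else q + 1)"
proof (cases "b = \<zero>")
  case True
  then have "{z \<in> carrier R. z [^] (q + 1) = b} = {\<zero>}"
    using nat_pow_eq_zero_iff[of _ "q + 1"] by (auto simp del: nat_pow_Suc)
  then show ?thesis using True by simp
next
  case False
  have "b [^] (q - 1) \<otimes> b = \<one> \<otimes> b" using assms bar_pow[of b] by simp
  then have "b [^] (q - 1) = \<one>" using assms False m_rcancel[of b "b [^] (q - 1)" \<one>] by simp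
  then show ?thesis
    using card_nth_roots[OF finite_carrier card_factor(1), of b] False assms by simp
qed

text \<open>A nonzero \<open>s\<close> has trace zero iff s^(q - 1) = -1. Since (-1)^(q + 1) = 1,
  this equation has q - 1 solutions, and s = 0 is one more.\<close>

lemma card_trace_zero: "card {s \<in> carrier R. s \<oplus> bar s = \<zero>} = q"
proof -
  have "bar \<one> = \<one>" by (simp add: bar_def)
  \<comment> \<open>Computing the power as a norm avoids a distinction by the parity of
    \<open>q\<close>.\<close>
  then have "(\<ominus> \<one>) [^] (q + 1) = \<ominus> \<one> \<otimes> \<ominus> \<one>"
    using norm_eq[of "\<ominus> \<one>"] by simp
  also have "\<dots> = \<one>" by (simp add: l_minus)
  finally have "card {x \<in> carrier R. x [^] (q - 1) = \<ominus> \<one>} = q - 1"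
    using card_nth_roots[OF finite_carrier card_factor(2), of "\<ominus> \<one>"] by simp
  moreover have "{s \<in> carrier R. s \<oplus> bar s = \<zero>} = insert \<zero> {x \<in> carrier R. x [^] (q - 1) = \<ominus> \<one>}"
  proof (intro equalityI subsetI)
    fix s assume s: "s \<in> {s \<in> carrier R. s \<oplus> bar s = \<zero>}"
    then have "(\<one> \<oplus> s [^] (q - 1)) \<otimes> s = \<zero>"
      using bar_pow[of s] by (simp add: l_distr)
    then have "s = \<zero> \<or> \<one> \<oplus> s [^] (q - 1) = \<zero>"
      using s integral[of "\<one> \<oplus> s [^] (q - 1)" s] by auto
    then show "s \<in> insert \<zero> {x \<in> carrier R. x [^] (q - 1) = \<ominus> \<one>}"
      using s minus_equality[of "s [^] (q - 1)" \<one>] by (auto simp: a_comm)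
  next
    fix s assume s: "s \<in> insert \<zero> {x \<in> carrier R. x [^] (q - 1) = \<ominus> \<one>}"
    then show "s \<in> {s \<in> carrier R. s \<oplus> bar s = \<zero>}"
      using bar_pow[of s] by (auto simp: l_minus r_neg)
  qed
  moreover have "\<zero> [^] (q - 1) \<noteq> \<ominus> \<one>"
    using q_ge_2 by (simp add: nat_pow_zero) (metis add.inv_eq_1_iff one_closed zero_not_one)
  ultimately show ?thesis
    using finite_carrier q_ge_2 by simp
qed

section \<open>The Hermitian form and its isotropic points\<close>

fun vbar :: "'a \<times> 'a \<times> 'a \<Rightarrow> 'a \<times> 'a \<times> 'a" where
  "vbar (x, y, z) = (bar x, bar y, bar z)"

definition herm :: "'a \<times> 'a \<times> 'a \<Rightarrow> 'a \<times> 'a \<times> 'a \<Rightarrow> 'a" where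
  "herm u v = vdot u (vbar v)"

lemma vbar_simps [simp]:
  "u \<in> vecs \<Longrightarrow> vbar u \<in> vecs"
  "u \<in> vecs \<Longrightarrow> vbar (vbar u) = u"
  "u \<in> vecs \<Longrightarrow> v \<in> vecs \<Longrightarrow> vbar (vadd u v) = vadd (vbar u) (vbar v)"
  "u \<in> vecs \<Longrightarrow> c \<in> carrier R \<Longrightarrow> vbar (vscale c u) = vscale (bar c) (vbar u)"
  "u \<in> vecs \<Longrightarrow> vbar u = vzero \<longleftrightarrow> u = vzero"
  by (cases u; cases v; simp)+

lemma bar_vdot: "u \<in> vecs \<Longrightarrow> v \<in> vecs \<Longrightarrow> bar (vdot u v) = vdot (vbar u) (vbar v)"
  by (cases u; cases v) simp

lemma bar_herm: "u \<in> vecs \<Longrightarrow> v \<in> vecs \<Longrightarrow> bar (herm u v) = herm v u"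
  by (simp add: herm_def bar_vdot vdot_commute)

lemma herm_simps [simp]:
  "u \<in> vecs \<Longrightarrow> v \<in> vecs \<Longrightarrow> herm u v \<in> carrier R"
  "u \<in> vecs \<Longrightarrow> v \<in> vecs \<Longrightarrow> w \<in> vecs \<Longrightarrow> herm (vadd u v) w = herm u w \<oplus> herm v w"
  "u \<in> vecs \<Longrightarrow> v \<in> vecs \<Longrightarrow> w \<in> vecs \<Longrightarrow> herm w (vadd u v) = herm w u \<oplus> herm w v"
  "u \<in> vecs \<Longrightarrow> v \<in> vecs \<Longrightarrow> c \<in> carrier R \<Longrightarrow> herm (vscale c u) v = c \<otimes> herm u v"
  "u \<in> vecs \<Longrightarrow> v \<in> vecs \<Longrightarrow> c \<in> carrier R \<Longrightarrow> herm u (vscale c v) = bar c \<otimes> herm u v"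
  by (simp_all add: herm_def)

lemma herm_self:
  "x \<in> carrier R \<Longrightarrow> y \<in> carrier R \<Longrightarrow> z \<in> carrier R \<Longrightarrow>
    herm (x, y, z) (x, y, z) = x [^] (q + 1) \<oplus> y [^] (q + 1) \<oplus> z [^] (q + 1)"
  using norm_eq by (simp add: herm_def)

lemma hunitalE:
  assumes "P \<in> hunital R q"
  obtains u where "u \<in> nzvecs R" "P = pspan R u" "herm u u = \<zero>"
proof -
  obtain x y z where "P = pspan R (x, y, z)" "(x, y, z) \<in> nzvecs R"
    "x [^] (q + 1) \<oplus> y [^] (q + 1) \<oplus> z [^] (q + 1) = \<zero>"
    using assms unfolding hunital_def by blast
  then show ?thesis using that[of "(x, y, z)"] herm_self by (simp add: nzvecs_eq)
qed

lemma hunital_iff: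
  assumes "u \<in> nzvecs R"
  shows "pspan R u \<in> hunital R q \<longleftrightarrow> herm u u = \<zero>"
proof
  assume "herm u u = \<zero>"
  then show "pspan R u \<in> hunital R q"
    using assms unfolding hunital_def
    by (cases u) (use herm_self in \<open>auto simp: nzvecs_eq simp del: nat_pow_Suc\<close>)
next
  assume "pspan R u \<in> hunital R q"
  then obtain v where v: "v \<in> nzvecs R" "pspan R u = pspan R v" "herm v v = \<zero>"
    using hunitalE by blast
  then obtain c where "c \<in> carrier R" "u = vscale c v"
    using pspan_eqD[of u v] assms by (auto simp: nzvecs_eq)
  then show "herm u u = \<zero>" using v by (simp add: nzvecs_eq)
qed

text \<open>If \<open>herm u v\<close> vanished, both \<open>u\<close> and \<open>v\<close> would be
  orthogonal to the conjugates of \<open>u\<close> and \<open>v\<close>, which span distinct points;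
  this determines a single point. So the form has no totally isotropic line.\<close>

lemma herm_isotropic_nonzero:
  assumes uv: "u \<in> nzvecs R" "v \<in> nzvecs R" "pspan R u \<noteq> pspan R v"
    and iso: "herm u u = \<zero>" "herm v v = \<zero>"
  shows "herm u v \<noteq> \<zero>"
proof
  assume 0: "herm u v = \<zero>"
  have car: "u \<in> vecs" "v \<in> vecs" using uv by (auto simp: nzvecs_eq)
  have 1: "herm v u = \<zero>" using 0 bar_herm[of u v] car by simp
  have nz: "vbar u \<in> nzvecs R" "vbar v \<in> nzvecs R" using uv by (simp_all add: nzvecs_eq)
  have "pspan R (vbar u) \<noteq> pspan R (vbar v)"
  proof
    assume "pspan R (vbar u) = pspan R (vbar v)"
    then obtain c where c: "c \<in> carrier R" "vbar u = vscale c (vbar v)"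
      using pspan_eqD[of "vbar u" "vbar v"] car by auto
    then have "u = vscale (bar c) v" using car by (metis vbar_simps(1,2,4))
    then show False using pspan_eq_of_vscale[of u v "bar c"] c uv car by simp
  qed
  from perp_pspan_unique[OF nz this uv(1) _ _ uv(2)] show False
    using 0 1 iso uv(3) by (simp add: herm_def)
qed

lemma vscale_cancel:
  assumes "u \<in> nzvecs R" "c \<in> carrier R" "d \<in> carrier R" "vscale c u = vscale d u"
  shows "c = d"
  using assms by (cases u) (auto simp: nzvecs_eq m_rcancel)

text \<open>Every point of the line other than the span of \<open>v\<close> is spanned by some u + t
  v. With c = \<open>herm u v\<close>, which is nonzero, that vector is isotropic iff s = bar t * c
  has trace zero. This leaves q values of \<open>t\<close>, and \<open>v\<close> contributes the
  last point.\<close>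

lemma card_secant:
  assumes uv: "u \<in> nzvecs R" "v \<in> nzvecs R" "pspan R u \<noteq> pspan R v"
    and iso: "herm u u = \<zero>" "herm v v = \<zero>"
    and l: "l \<in> nzvecs R" "vdot l u = \<zero>" "vdot l v = \<zero>"
  shows "card (pline R l \<inter> hunital R q) = q + 1"
proof -
  have car: "u \<in> vecs" "v \<in> vecs" "l \<in> vecs" using uv l by (auto simp: nzvecs_eq)
  define c where "c = herm u v"
  have c: "c \<in> carrier R" "c \<noteq> \<zero>" "herm v u = bar c"
    using herm_isotropic_nonzero[OF uv iso] car bar_herm by (auto simp: c_def)
  let ?w = "\<lambda>t. vadd u (vscale t v)"
  have w_vecs: "?w t \<in> vecs" if "t \<in> carrier R" for t using that car by simp
  have not_par: "vadd (vscale a u) (vscale b v) \<noteq> vzero" if "a \<in> carrier R" "b \<in> carrier R" "a \<noteq> \<zero>" for a b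
  proof
    assume "vadd (vscale a u) (vscale b v) = vzero"
    then have "herm (vadd (vscale a u) (vscale b v)) v = \<zero>" using car by (simp add: herm_def)
    then show False using that car iso c by (simp add: c_def[symmetric] integral_iff)
  qed
  have w_nz: "?w t \<in> nzvecs R" if "t \<in> carrier R" for t
    using not_par[of \<one> t] that car by (simp add: nzvecs_eq vector_space_simps)
  have herm_w: "herm (?w t) (?w t) = bar t \<otimes> c \<oplus> t \<otimes> bar c" if "t \<in> carrier R" for t
    using that car iso c by (simp add: c_def[symmetric] a_comm)
  define T where "T = {t \<in> carrier R. bar t \<otimes> c \<oplus> t \<otimes> bar c = \<zero>}"
  have "card T = q"
  proof -
    have cu: "c \<in> Units R" using c field_Units by auto
    have "bij_betw (\<lambda>t. bar t \<otimes> c) T {s \<in> carrier R. s \<oplus> bar s = \<zero>}"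
    proof (rule bij_betw_byWitness[where f' = "\<lambda>s. bar (s \<otimes> inv c)"])
      show "\<forall>t\<in>T. bar (bar t \<otimes> c \<otimes> inv c) = t"
        using cu c by (auto simp: T_def m_assoc)
      show "\<forall>s\<in>{s \<in> carrier R. s \<oplus> bar s = \<zero>}. bar (bar (s \<otimes> inv c)) \<otimes> c = s"
        using cu c by (auto simp: m_assoc)
      show "(\<lambda>t. bar t \<otimes> c) ` T \<subseteq> {s \<in> carrier R. s \<oplus> bar s = \<zero>}"
        using c by (auto simp: T_def)
      show "(\<lambda>s. bar (s \<otimes> inv c)) ` {s \<in> carrier R. s \<oplus> bar s = \<zero>} \<subseteq> T"
      proof (rule image_subsetI)
        fix s assume s: "s \<in> {s \<in> carrier R. s \<oplus> bar s = \<zero>}"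
        have a: "s \<otimes> inv c \<otimes> c = s" using s c cu by (simp add: m_assoc)
        then have "bar (s \<otimes> inv c) \<otimes> bar c = bar s" using s c cu by (metis Units_inv_closed bar_mult m_closed mem_Collect_eq)
        with a show "bar (s \<otimes> inv c) \<in> T" using s c cu by (simp add: T_def)
      qed
    qed
    then show ?thesis using bij_betw_same_card card_trace_zero by fastforce
  qed
  have "pline R l \<inter> hunital R q = insert (pspan R v) ((\<lambda>t. pspan R (?w t)) ` T)"
  proof (intro equalityI subsetI)
    fix P assume P: "P \<in> pline R l \<inter> hunital R q"
    then obtain x where x: "x \<in> nzvecs R" "P = pspan R x" "herm x x = \<zero>"
      using hunitalE by blast
    then have "vdot l x = \<zero>" using P mem_pline_iff car by auto
    then obtain a b where ab: "a \<in> carrier R" "b \<in> carrier R" "x = vadd (vscale a u) (vscale b v)"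
      using on_line_span[OF uv l, of x] x by (auto simp: nzvecs_eq)
    show "P \<in> insert (pspan R v) ((\<lambda>t. pspan R (?w t)) ` T)"
    proof (cases "a = \<zero>")
      case True
      then have "x = vscale b v" using ab car by (simp add: vector_space_simps)
      then show ?thesis using pspan_eq_of_vscale[of x v b] x ab car by simp
    next
      case False
      then have au: "a \<in> Units R" using ab field_Units by auto
      define t where "t = inv a \<otimes> b"
      have t: "t \<in> carrier R" "a \<otimes> t = b" using au ab by (auto simp: t_def m_assoc[symmetric])
      have xw: "x = vscale a (?w t)"
        using ab t car by (simp add: vector_space_simps)
      then have P': "P = pspan R (?w t)" using pspan_eq_of_vscale[OF x(1) _ ab(1) xw] w_vecs t x by simp
      then have "herm (?w t) (?w t) = \<zero>" using P hunital_iff[OF w_nz[OF t(1)]] by simp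
      then have "t \<in> T" using herm_w t by (simp add: T_def)
      then show ?thesis using P' by blast
    qed
  next
    fix P assume "P \<in> insert (pspan R v) ((\<lambda>t. pspan R (?w t)) ` T)"
    then show "P \<in> pline R l \<inter> hunital R q"
    proof
      assume "P = pspan R v"
      then show ?thesis using mem_pline_iff hunital_iff uv l iso car by simp
    next
      assume "P \<in> (\<lambda>t. pspan R (?w t)) ` T"
      then obtain t where t: "t \<in> carrier R" "bar t \<otimes> c \<oplus> t \<otimes> bar c = \<zero>" "P = pspan R (?w t)"
        by (auto simp: T_def)
      then show ?thesis
        using mem_pline_iff[OF car(3) w_nz[OF t(1)]] hunital_iff[OF w_nz[OF t(1)]] herm_w[OF t(1)] l car
        by simp
    qed
  qed
  moreover have "inj_on (\<lambda>t. pspan R (?w t)) T"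
  proof (rule inj_onI)
    fix t s assume "t \<in> T" "s \<in> T" and eq: "pspan R (?w t) = pspan R (?w s)"
    then have ts: "t \<in> carrier R" "s \<in> carrier R" by (auto simp: T_def)
    obtain k where k: "k \<in> carrier R" "?w t = vscale k (?w s)"
      using pspan_eqD[OF _ _ eq] w_vecs ts by blast
    \<comment> \<open>Pairing with \<open>v\<close> forces k = 1; after that, pairing with
      \<open>u\<close> recovers the parameter.\<close>
    have "herm (?w t) v = k \<otimes> herm (?w s) v" using k ts car by simp
    then have "c = k \<otimes> c" using ts car iso by (simp add: c_def)
    then have "k \<otimes> c = \<one> \<otimes> c" using c by simp
    then have "k = \<one>" using k c m_rcancel[of c k \<one>] by simp
    then have "?w t = ?w s" using k w_vecs ts by (simp add: vector_space_simps)
    then have "herm (?w t) u = herm (?w s) u" by simp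
    then have "t \<otimes> bar c = s \<otimes> bar c" using ts car iso c by simp
    then show "t = s" using ts c m_rcancel[of "bar c" t s] by simp
  qed
  moreover have "pspan R v \<notin> (\<lambda>t. pspan R (?w t)) ` T"
  proof
    assume "pspan R v \<in> (\<lambda>t. pspan R (?w t)) ` T"
    then obtain t where t: "t \<in> carrier R" "pspan R (?w t) = pspan R v" by (auto simp: T_def)
    then obtain k where k: "k \<in> carrier R" "?w t = vscale k v"
      using pspan_eqD[OF _ _ t(2)] w_vecs car by blast
    then have "herm (?w t) v = k \<otimes> herm v v" using car by simp
    then show False using t(1) k(1) iso c car by (simp add: c_def[symmetric])
  qed
  moreover have "finite T" using finite_carrier by (simp add: T_def)
  ultimately show ?thesis using \<open>card T = q\<close> by (simp add: card_image)
qed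

section \<open>Counting isotropic vectors and points of the unital\<close>

lemma card_isotropic_pairs:
  "card {(x, y) \<in> carrier R \<times> carrier R. x [^] (q + 1) \<oplus> y [^] (q + 1) = \<zero>} = 1 + (q ^ 2 - 1) * (q + 1)"
proof -
  let ?N = "\<lambda>x. x [^] (q + 1)"
  \<comment> \<open>For fixed \<open>x\<close> the norm of \<open>y\<close> is prescribed: one
    choice of \<open>y\<close> if \<open>x\<close> is 0, and q + 1 choices otherwise.\<close>
  have "{(x, y) \<in> carrier R \<times> carrier R. ?N x \<oplus> ?N y = \<zero>} =
      (SIGMA x:carrier R. {y \<in> carrier R. ?N y = \<ominus> ?N x})"
  proof (intro equalityI subsetI)
    fix p assume "p \<in> {(x, y) \<in> carrier R \<times> carrier R. ?N x \<oplus> ?N y = \<zero>}"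
    then obtain x y where "p = (x, y)" "x \<in> carrier R" "y \<in> carrier R" "?N x \<oplus> ?N y = \<zero>" by blast
    moreover from this have "\<ominus> ?N x = ?N y"
      by (intro minus_equality) (auto simp: a_comm simp del: nat_pow_Suc)
    ultimately show "p \<in> (SIGMA x:carrier R. {y \<in> carrier R. ?N y = \<ominus> ?N x})" by simp
  qed (auto simp: r_neg simp del: nat_pow_Suc)
  also have "card \<dots> = (\<Sum>x\<in>carrier R. card {y \<in> carrier R. ?N y = \<ominus> ?N x})"
    using finite_carrier by (intro card_SigmaI) auto
  also have "\<dots> = (\<Sum>x\<in>carrier R. if x = \<zero> then 1 else q + 1)"
  proof (rule sum.cong)
    fix x assume x: "x \<in> carrier R"
    have "bar (\<ominus> ?N x) = \<ominus> ?N x"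
      using x norm_eq[OF x] by (simp add: m_comm)
    moreover have "\<ominus> ?N x = \<zero> \<longleftrightarrow> x = \<zero>"
      using x nat_pow_eq_zero_iff[of x "q + 1"] add.inv_eq_1_iff[of "?N x"] by (simp del: nat_pow_Suc)
    ultimately show "card {y \<in> carrier R. ?N y = \<ominus> ?N x} = (if x = \<zero> then 1 else q + 1)"
      using card_norm_fibre[of "\<ominus> ?N x"] x by (simp del: nat_pow_Suc)
  qed simp
  also have "\<dots> = 1 + (\<Sum>x\<in>carrier R - {\<zero>}. if x = \<zero> then 1 else q + 1)"
    using finite_carrier by (subst sum.remove[of _ \<zero>]) auto
  also have "(\<Sum>x\<in>carrier R - {\<zero>}. if x = \<zero> then 1 else q + 1) = (\<Sum>x\<in>carrier R - {\<zero>}. q + 1)"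
    by (intro sum.cong) auto
  finally show ?thesis using finite_carrier card_carrier by simp
qed

text \<open>Over (x, y) there is one \<open>z\<close> if the norms of \<open>x\<close> and
  \<open>y\<close> cancel, and there are q + 1 otherwise. The first case occurs M = q^3 + q^2 - q
  times, so the total is M + (q + 1) (q^4 - M) = q^5 - q^3 + q^2. The term q^3 stands on the left to
  avoid natural subtraction.\<close>

lemma card_isotropic_vecs:
  "card {u \<in> vecs. herm u u = \<zero>} + q ^ 3 = q ^ 5 + q ^ 2"
proof -
  let ?N = "\<lambda>x. x [^] (q + 1)"
  let ?C = "carrier R \<times> carrier R"
  let ?M = "{(x, y) \<in> ?C. ?N x \<oplus> ?N y = \<zero>}"
  have "bij_betw (\<lambda>((x, y), z). (x, y, z))
      (SIGMA p:?C. {z \<in> carrier R. ?N z = \<ominus> (?N (fst p) \<oplus> ?N (snd p))}) {u \<in> vecs. herm u u = \<zero>}"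
  proof (rule bij_betw_byWitness[where f' = "\<lambda>(x, y, z). ((x, y), z)"])
    show "(\<lambda>((x, y), z). (x, y, z)) `
        (SIGMA p:?C. {z \<in> carrier R. ?N z = \<ominus> (?N (fst p) \<oplus> ?N (snd p))}) \<subseteq> {u \<in> vecs. herm u u = \<zero>}"
      using herm_self by (auto simp: r_neg simp del: nat_pow_Suc)
    show "(\<lambda>(x, y, z). ((x, y), z)) ` {u \<in> vecs. herm u u = \<zero>} \<subseteq>
        (SIGMA p:?C. {z \<in> carrier R. ?N z = \<ominus> (?N (fst p) \<oplus> ?N (snd p))})"
    proof (rule image_subsetI)
      fix u assume u: "u \<in> {u \<in> vecs. herm u u = \<zero>}"
      obtain x y z where xyz: "u = (x, y, z)" by (rule prod_cases3)
      then have c: "x \<in> carrier R" "y \<in> carrier R" "z \<in> carrier R" "?N x \<oplus> ?N y \<oplus> ?N z = \<zero>"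
        using u herm_self by auto
      then have "\<ominus> (?N x \<oplus> ?N y) = ?N z"
        by (intro minus_equality) (auto simp: a_comm simp del: nat_pow_Suc)
      then show "(\<lambda>(x, y, z). ((x, y), z)) u \<in>
          (SIGMA p:?C. {z \<in> carrier R. ?N z = \<ominus> (?N (fst p) \<oplus> ?N (snd p))})"
        using c xyz by simp
    qed
  qed auto
  then have "card {u \<in> vecs. herm u u = \<zero>} =
      card (SIGMA p:?C. {z \<in> carrier R. ?N z = \<ominus> (?N (fst p) \<oplus> ?N (snd p))})"
    using bij_betw_same_card by fastforce
  also have "\<dots> = (\<Sum>p\<in>?C. card {z \<in> carrier R. ?N z = \<ominus> (?N (fst p) \<oplus> ?N (snd p))})"
    using finite_carrier by (intro card_SigmaI) auto
  also have "\<dots> = (\<Sum>p\<in>?C. if p \<in> ?M then 1 else q + 1)"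
  proof (rule sum.cong)
    fix p assume "p \<in> ?C"
    then obtain x y where p: "p = (x, y)" "x \<in> carrier R" "y \<in> carrier R" by auto
    have "bar (\<ominus> (?N x \<oplus> ?N y)) = \<ominus> (?N x \<oplus> ?N y)"
      using p norm_eq[OF p(2)] norm_eq[OF p(3)] by (simp add: m_comm)
    moreover have "\<ominus> (?N x \<oplus> ?N y) = \<zero> \<longleftrightarrow> ?N x \<oplus> ?N y = \<zero>"
      using p add.inv_eq_1_iff[of "?N x \<oplus> ?N y"] by (simp del: nat_pow_Suc)
    ultimately show "card {z \<in> carrier R. ?N z = \<ominus> (?N (fst p) \<oplus> ?N (snd p))} =
        (if p \<in> ?M then 1 else q + 1)"
      using card_norm_fibre[of "\<ominus> (?N x \<oplus> ?N y)"] p by (simp del: nat_pow_Suc)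
  qed simp
  also have "\<dots> = card ?M + (q + 1) * (q ^ 4 - card ?M)"
  proof -
    have fin: "finite ?C" using finite_carrier by simp
    have sub: "?M \<subseteq> ?C" by auto
    have "card ?C = q ^ 4" by (simp add: card_cartesian_product card_carrier flip: power_add)
    then have "card (?C - ?M) = q ^ 4 - card ?M"
      using card_Diff_subset[OF finite_subset[OF sub fin] sub] by simp
    moreover have "(\<Sum>p\<in>?C. if p \<in> ?M then 1 else q + 1) = (\<Sum>p\<in>?M. 1) + (\<Sum>p\<in>?C - ?M. q + 1)"
      using fin sub by (subst sum.subset_diff[OF sub fin]) (simp add: add.commute)
    ultimately show ?thesis by simp
  qed
  finally have eq: "card {u \<in> vecs. herm u u = \<zero>} = card ?M + (q + 1) * (q ^ 4 - card ?M)" .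
  obtain r where r: "q = Suc r" using q_ge_2 by (cases q) auto
  have "card ?M = 1 + (q ^ 2 - 1) * (q + 1)" by (rule card_isotropic_pairs)
  then have M: "int (card ?M) = int q ^ 3 + int q ^ 2 - int q"
    by (simp add: r algebra_simps power2_eq_square power3_eq_cube)
  have "card ?M \<le> q ^ 4"
    using card_mono[of ?C ?M] finite_carrier by (auto simp: card_cartesian_product card_carrier simp flip: power_add)
  then have "int (card ?M + (q + 1) * (q ^ 4 - card ?M)) = int (card ?M) + (int q + 1) * (int q ^ 4 - int (card ?M))"
    by (simp only: of_nat_add of_nat_mult of_nat_diff of_nat_power of_nat_1)
  then have "int (card {u \<in> vecs. herm u u = \<zero>}) = int (card ?M) + (int q + 1) * (int q ^ 4 - int (card ?M))"
    by (simp only: eq)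
  then have "int (card {u \<in> vecs. herm u u = \<zero>} + q ^ 3) = int (q ^ 5 + q ^ 2)"
    unfolding M by (simp add: algebra_simps power2_eq_square power3_eq_cube power4_eq_xxxx eval_nat_numeral)
  then show ?thesis by linarith
qed

text \<open>The q^5 - q^3 + q^2 - 1 = (q^2 - 1) (q^3 + 1) nonzero isotropic vectors are partitioned
  by the points of the unital, each consisting of q^2 - 1 vectors because \<open>pspan\<close> omits
  the zero vector.\<close>

lemma card_hunital: "card (hunital R q) = q ^ 3 + 1"
proof -
  let ?I = "{u \<in> vecs. herm u u = \<zero>}"
  have fin_vecs: "finite vecs" using finite_carrier by (simp add: vecs_def)
  have fin: "finite (hunital R q)"
  proof (rule finite_subset)
    show "hunital R q \<subseteq> pspan R ` vecs"
      by (auto elim!: hunitalE simp: nzvecs_eq simp del: split_paired_All)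
  qed (use fin_vecs in simp)
  have un: "\<Union>(hunital R q) = ?I - {vzero}"
  proof (intro equalityI subsetI)
    fix x assume "x \<in> \<Union>(hunital R q)"
    then obtain P where "x \<in> P" "P \<in> hunital R q" by blast
    then obtain u where u: "u \<in> nzvecs R" "herm u u = \<zero>" "x \<in> pspan R u"
      using hunitalE by blast
    then obtain c where c: "c \<in> carrier R" "c \<noteq> \<zero>" "x = vscale c u" by (auto simp: pspan_eq)
    then show "x \<in> ?I - {vzero}"
      using u vscale_eq_vzero_iff[of u c] by (simp add: nzvecs_eq)
  next
    fix x assume x: "x \<in> ?I - {vzero}"
    then have "pspan R x \<in> hunital R q" using hunital_iff[of x] by (simp add: nzvecs_eq)
    then show "x \<in> \<Union>(hunital R q)" using pspan_self[of x] x by blast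
  qed
  have "(q ^ 2 - 1) * card (hunital R q) = card (\<Union>(hunital R q))"
  proof (rule card_partition)
    show "finite (\<Union>(hunital R q))" unfolding un using fin_vecs by simp
    show "card P = q ^ 2 - 1" if "P \<in> hunital R q" for P
    proof -
      obtain u where u: "u \<in> nzvecs R" "P = pspan R u" using \<open>P \<in> hunital R q\<close> hunitalE by blast
      have "P = (\<lambda>c. vscale c u) ` (carrier R - {\<zero>})" using u by (auto simp: pspan_eq)
      moreover have "inj_on (\<lambda>c. vscale c u) (carrier R - {\<zero>})"
        using vscale_cancel[OF u(1)] by (intro inj_onI) blast
      ultimately show ?thesis using finite_carrier card_carrier by (simp add: card_image)
    qed
    show "P \<inter> Q = {}" if "P \<in> hunital R q" "Q \<in> hunital R q" "P \<noteq> Q" for P Q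
    proof (rule ccontr)
      assume "P \<inter> Q \<noteq> {}"
      then obtain x where x: "x \<in> P" "x \<in> Q" by blast
      have "P' = pspan R x" if "P' \<in> hunital R q" "x \<in> P'" for P'
      proof -
        obtain u where u: "u \<in> nzvecs R" "P' = pspan R u" using \<open>P' \<in> hunital R q\<close> hunitalE by blast
        then obtain c where "c \<in> carrier R" "c \<noteq> \<zero>" "x = vscale c u"
          using \<open>x \<in> P'\<close> by (auto simp: pspan_eq)
        then show ?thesis using u pspan_eqI[of u c] by (simp add: nzvecs_eq)
      qed
      then show False using that x by metis
    qed
  qed (rule fin)
  also have "\<dots> = card ?I - 1"
    unfolding un using fin_vecs by (subst card_Diff_singleton) (auto simp: herm_def)
  finally have "(q ^ 2 - 1) * card (hunital R q) = card ?I - 1" .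
  moreover have "card ?I = q ^ 5 + q ^ 2 - q ^ 3" using card_isotropic_vecs by simp
  ultimately have "(q ^ 2 - 1) * card (hunital R q) = q ^ 5 + q ^ 2 - q ^ 3 - 1" by simp
  moreover have "(q ^ 2 - 1) * (q ^ 3 + 1) = q ^ 5 + q ^ 2 - q ^ 3 - 1"
    by (simp add: algebra_simps flip: power_add)
  ultimately have "(q ^ 2 - 1) * card (hunital R q) = (q ^ 2 - 1) * (q ^ 3 + 1)" by simp
  moreover have "q ^ 2 > 1" using q_ge_2 by (intro one_less_power) auto
  ultimately show ?thesis by (simp only: mult_cancel1) auto
qed

section \<open>The Hermitian unital as a design, and its triangles\<close>

lemma secants_plines: "l \<in> secants R q \<Longrightarrow> l \<in> plines R"
  by (simp add: secants_def)

sublocale unital "hunital R q" "secants R q" q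
proof
  have "finite (nzvecs R)" using finite_carrier by (simp add: nzvecs_eq vecs_def)
  then show "finite (secants R q)" by (simp add: secants_def plines_def)
  show "card (hunital R q) = q ^ 3 + 1" by (rule card_hunital)
  show "q \<ge> 2" by (rule q_ge_2)
next
  fix l assume "l \<in> secants R q"
  then show "card (l \<inter> hunital R q) = q + 1" by (simp add: secants_def)
next
  fix P Q assume "P \<in> hunital R q" "Q \<in> hunital R q" "P \<noteq> Q"
  then obtain u v where u: "u \<in> nzvecs R" "P = pspan R u" "herm u u = \<zero>"
    and v: "v \<in> nzvecs R" "Q = pspan R v" "herm v v = \<zero>"
    using hunitalE by metis
  then have ne: "pspan R u \<noteq> pspan R v" using \<open>P \<noteq> Q\<close> by simp
  obtain l where l: "l \<in> nzvecs R" "vdot l u = \<zero>" "vdot l v = \<zero>"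
    using plines_joined[OF u(1) v(1) ne] by blast
  \<comment> \<open>The line joining two points of the unital is always a secant, since
    \<open>card_secant\<close> counts its points exactly.\<close>
  have "pline R l \<in> secants R q"
    using card_secant[OF u(1) v(1) ne u(3) v(3) l] l by (simp add: secants_def plines_def)
  moreover have "P \<in> pline R l" "Q \<in> pline R l"
    using l u v mem_pline_iff by (simp_all add: nzvecs_eq)
  ultimately show "\<exists>l\<in>secants R q. P \<in> l \<and> Q \<in> l" by blast
next
  fix l m P Q
  assume "l \<in> secants R q" "m \<in> secants R q" "l \<noteq> m" "P \<in> l" "P \<in> m" "Q \<in> l" "Q \<in> m"
  then show "P = Q"
    using plines_meet[of l m] secants_plines by (metis IntI singletonD)
qed

text \<open>Distinct secants have a singleton intersection, so the \<open>the_elem\<close> in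
  \<open>meet\<close> is meaningful and can be traded for membership.\<close>

lemma meet_eq_iff:
  assumes "l \<in> secants R q" "m \<in> secants R q" "l \<noteq> m"
  shows "meet l m = P \<longleftrightarrow> P \<in> l \<inter> m"
proof -
  obtain Q where "l \<inter> m = {Q}" using plines_meet assms secants_plines by metis
  then show ?thesis by (auto simp: meet_def)
qed

text \<open>The design side describes triangles by incidence with existential corners, as it has no
  meet operation; here the corners are identified with the values of \<open>meet\<close>.\<close>

lemma proper_triangle_iff:
  "proper_triangle l1 l2 l3 \<longleftrightarrow>
      l1 \<in> secants R q \<and> l2 \<in> secants R q \<and> l3 \<in> secants R q \<and>
      Hadj R q l1 l2 \<and> Hadj R q l2 l3 \<and> Hadj R q l1 l3 \<and>
      meet l1 l2 \<noteq> meet l2 l3 \<and> meet l1 l2 \<noteq> meet l1 l3 \<and> meet l2 l3 \<noteq> meet l1 l3"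
  (is "_ \<longleftrightarrow> ?r")
proof
  assume "proper_triangle l1 l2 l3"
  then obtain A B C where *: "l1 \<in> secants R q" "l2 \<in> secants R q" "l3 \<in> secants R q"
    "l1 \<noteq> l2" "l2 \<noteq> l3" "l1 \<noteq> l3" "A \<noteq> B" "B \<noteq> C" "A \<noteq> C"
    "A \<in> hunital R q \<inter> l1 \<inter> l2" "B \<in> hunital R q \<inter> l2 \<inter> l3" "C \<in> hunital R q \<inter> l1 \<inter> l3"
    unfolding proper_triangle_def by blast
  then have "meet l1 l2 = A" "meet l2 l3 = B" "meet l1 l3 = C"
    using meet_eq_iff by simp_all
  with * show ?r by (simp add: Hadj_def)
next
  assume r: ?r
  then have ne: "l1 \<noteq> l2" "l2 \<noteq> l3" "l1 \<noteq> l3" by (simp_all add: Hadj_def)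
  have "meet l1 l2 \<in> hunital R q \<inter> l1 \<inter> l2" "meet l2 l3 \<in> hunital R q \<inter> l2 \<inter> l3"
    "meet l1 l3 \<in> hunital R q \<inter> l1 \<inter> l3"
    using r ne meet_eq_iff[of l1 l2 "meet l1 l2"] meet_eq_iff[of l2 l3 "meet l2 l3"]
      meet_eq_iff[of l1 l3 "meet l1 l3"] by (simp_all add: Hadj_def)
  with r ne show "proper_triangle l1 l2 l3" unfolding proper_triangle_def by metis
qed

lemma Htri_eq: "Htri R q = proper_triangles"
  unfolding Htri_def proper_triangles_def proper_triangle_iff ..

section \<open>Absence of O'Nan configurations\<close>

abbreviation vdiff :: "'a \<times> 'a \<times> 'a \<Rightarrow> 'a \<times> 'a \<times> 'a \<Rightarrow> 'a \<times> 'a \<times> 'a" where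
  "vdiff u v \<equiv> vadd u (vscale (\<ominus> \<one>) v)"

text \<open>Expanding the form at u - v leaves only the two mixed terms, each with a minus
  sign.\<close>

lemma herm_skew_of_isotropic_diff:
  assumes "u \<in> vecs" "v \<in> vecs" "herm u u = \<zero>" "herm v v = \<zero>" "herm (vdiff u v) (vdiff u v) = \<zero>"
  shows "herm v u = \<ominus> herm u v"
proof -
  have "bar \<one> = \<one>" by (simp add: bar_def)
  then have "\<ominus> (herm v u \<oplus> herm u v) = \<zero>"
    using assms by (simp add: l_minus minus_add a_comm)
  then have "herm v u \<oplus> herm u v = \<zero>"
    using assms by (metis a_closed add.inv_eq_1_iff herm_simps(1))
  then show ?thesis
    using assms by (metis herm_simps(1) minus_equality)
qed

text \<open>The Gram matrix of \<open>u\<^sub>1, u\<^sub>2, u\<^sub>3\<close> is alternating of odd size, so it has the explicit kernel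
  vector \<open>w\<close>; nondegeneracy of the form then makes the three points collinear.\<close>

lemma no_alternating_gram:
  assumes nz: "u1 \<in> nzvecs R" "u2 \<in> nzvecs R" "u3 \<in> nzvecs R" "pspan R u1 \<noteq> pspan R u2"
    and iso: "herm u1 u1 = \<zero>" "herm u2 u2 = \<zero>" "herm u3 u3 = \<zero>"
    and skew: "herm u2 u1 = \<ominus> herm u1 u2" "herm u3 u2 = \<ominus> herm u2 u3" "herm u1 u3 = \<ominus> herm u3 u1"
    and ncol: "\<And>l. l \<in> nzvecs R \<Longrightarrow> vdot l u1 = \<zero> \<Longrightarrow> vdot l u2 = \<zero> \<Longrightarrow> vdot l u3 \<noteq> \<zero>"
  shows False
proof -
  have car: "u1 \<in> vecs" "u2 \<in> vecs" "u3 \<in> vecs" using nz by (auto simp: nzvecs_eq)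
  define \<alpha> \<beta> \<gamma> where "\<alpha> = herm u1 u2" and "\<beta> = herm u2 u3" and "\<gamma> = herm u3 u1"
  have sc: "\<alpha> \<in> carrier R" "\<beta> \<in> carrier R" "\<gamma> \<in> carrier R" using car by (auto simp: \<alpha>_def \<beta>_def \<gamma>_def)
  have gram: "herm u1 u2 = \<alpha>" "herm u2 u1 = \<ominus> \<alpha>" "herm u2 u3 = \<beta>" "herm u3 u2 = \<ominus> \<beta>"
    "herm u3 u1 = \<gamma>" "herm u1 u3 = \<ominus> \<gamma>"
    using skew by (auto simp: \<alpha>_def \<beta>_def \<gamma>_def)
  have "\<alpha> \<noteq> \<zero>" using herm_isotropic_nonzero[OF nz(1,2,4) iso(1,2)] by (simp add: \<alpha>_def)
  define w where "w = vadd (vscale \<beta> u1) (vadd (vscale \<gamma> u2) (vscale \<alpha> u3))"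
  have w: "w \<in> vecs" using sc car by (simp add: w_def)
  have "herm w u1 = \<zero>" "herm w u2 = \<zero>" "herm w u3 = \<zero>"
    unfolding w_def using sc car by (simp_all add: iso gram r_minus m_comm l_neg r_neg)
  moreover have "vdot (vbar w) u = \<zero>" if "herm w u = \<zero>" "u \<in> vecs" for u
    using bar_vdot[of w "vbar u"] w that by (simp add: herm_def)
  ultimately have "vdot (vbar w) u1 = \<zero>" "vdot (vbar w) u2 = \<zero>" "vdot (vbar w) u3 = \<zero>"
    using car by blast+
  \<comment> \<open>A nonzero \<open>vbar w\<close> would be the coordinate vector of a line through
    all three points.\<close>
  then have "vbar w \<notin> nzvecs R" using ncol[of "vbar w"] by blast
  then have w0: "w = vzero" using w by (simp add: nzvecs_eq)
  obtain l where l: "l \<in> nzvecs R" "vdot l u1 = \<zero>" "vdot l u2 = \<zero>"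
    using plines_joined[OF nz(1,2,4)] by blast
  have lv: "l \<in> vecs" using l by (simp add: nzvecs_eq)
  \<comment> \<open>Evaluating the line through \<open>u1\<close> and \<open>u2\<close> on
    \<open>w\<close> isolates the term of \<open>u3\<close>. As \<open>w\<close> is zero and
    \<alpha> is not, the line contains \<open>u3\<close> as well.\<close>
  have "vdot l w = \<alpha> \<otimes> vdot l u3"
    unfolding w_def using sc car l lv by simp
  then have "\<alpha> \<otimes> vdot l u3 = \<zero>" using w0 lv by simp
  then show False using \<open>\<alpha> \<noteq> \<zero>\<close> ncol[OF l] sc car lv by (simp add: integral_iff)
qed

text \<open>Normalising all three vertices of a triangle by \<open>d\<^sub>0 \<bullet> u = 1\<close> puts the intersections of the
  line \<open>d\<^sub>0\<close> with the sides at the differences of the vertices.\<close>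

lemma isotropic_diff:
  assumes uv: "u \<in> nzvecs R" "v \<in> nzvecs R" "pspan R u \<noteq> pspan R v"
    and m: "m \<in> nzvecs R" "vdot m u = \<zero>" "vdot m v = \<zero>"
    and d: "d \<in> nzvecs R" "vdot d u = \<one>" "vdot d v = \<one>"
    and P: "P \<in> hunital R q" "P \<in> pline R m" "P \<in> pline R d"
  shows "herm (vdiff u v) (vdiff u v) = \<zero>"
proof -
  have car: "u \<in> vecs" "v \<in> vecs" "m \<in> vecs" "d \<in> vecs" using uv m d by (auto simp: nzvecs_eq)
  obtain x where x: "x \<in> nzvecs R" "P = pspan R x" "herm x x = \<zero>"
    using P hunitalE by blast
  then have dots: "vdot m x = \<zero>" "vdot d x = \<zero>" using P mem_pline_iff car by auto
  obtain a b where ab: "a \<in> carrier R" "b \<in> carrier R" "x = vadd (vscale a u) (vscale b v)"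
    using on_line_span[OF uv m, of x] dots x by (auto simp: nzvecs_eq)
  \<comment> \<open>Both \<open>u\<close> and \<open>v\<close> have dot product 1 with
    \<open>d\<close>, so a point on \<open>d\<close> has coefficients summing to zero and is a
    multiple of u - v.\<close>
  have "a \<oplus> b = \<zero>" using dots(2) ab car d by simp
  then have "b = a \<otimes> \<ominus> \<one>" using ab minus_equality[of b a] by (simp add: r_minus a_comm)
  then have xa: "x = vscale a (vdiff u v)"
    using ab car by (simp add: vector_space_simps)
  then have "a \<noteq> \<zero>" using x car by (auto simp: nzvecs_eq vector_space_simps(3))
  have "vdiff u v \<in> vecs" using car by simp
  with x(3) xa ab(1) have "a \<otimes> (bar a \<otimes> herm (vdiff u v) (vdiff u v)) = \<zero>"
    by (metis bar_closed herm_simps(1,4,5) m_lcomm vec_closed(1))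
  with \<open>a \<noteq> \<zero>\<close> ab(1) \<open>vdiff u v \<in> vecs\<close> show ?thesis
    by (metis bar_closed bar_eq_zero_iff herm_simps(1) integral m_closed)
qed

text \<open>The triangle is cut out by \<open>a\<close>, \<open>b\<close>, \<open>c\<close>, with
  \<open>u1\<close> on b and c, \<open>u2\<close> on a and c, \<open>u3\<close> on a and b; the line
  \<open>d\<close> normalises these vectors. Its meets with c, a and b make the form skew on the
  pairs (u1, u2), (u2, u3) and (u3, u1).\<close>

theorem no_onan_configuration:
  assumes "proper_triangle a b c" "proper_triangle a b d" "proper_triangle a c d" "proper_triangle b c d"
  shows False
proof -
  have lines: "a \<in> secants R q" "b \<in> secants R q" "c \<in> secants R q" "d \<in> secants R q"
    and ne: "a \<noteq> b" "a \<noteq> c" "b \<noteq> c" "a \<noteq> d" "b \<noteq> d" "c \<noteq> d"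
    using assms by (simp_all add: proper_triangle_def)
  have on: "meet l m \<in> hunital R q" "meet l m \<in> l" "meet l m \<in> m"
    if "Hadj R q l m" "l \<in> secants R q" "m \<in> secants R q" for l m
    using that meet_eq_iff[of l m "meet l m"] by (auto simp: Hadj_def)
  have adj: "Hadj R q a b" "Hadj R q a c" "Hadj R q b c" "Hadj R q a d" "Hadj R q b d" "Hadj R q c d"
    and meets: "meet b c \<noteq> meet b d" "meet a c \<noteq> meet a d" "meet a b \<noteq> meet a d"
      "meet a b \<noteq> meet b c" "meet a b \<noteq> meet a c" "meet b c \<noteq> meet a c"
    using assms unfolding proper_triangle_iff by simp_all
  note ab = on[OF adj(1) lines(1,2)] and ac = on[OF adj(2) lines(1,3)] and bc = on[OF adj(3) lines(2,3)]
    and ad = on[OF adj(4) lines(1,4)] and bd = on[OF adj(5) lines(2,4)] and cd = on[OF adj(6) lines(3,4)]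
  obtain a0 b0 c0 d0 where coords: "a0 \<in> nzvecs R" "b0 \<in> nzvecs R" "c0 \<in> nzvecs R" "d0 \<in> nzvecs R"
    "a = pline R a0" "b = pline R b0" "c = pline R c0" "d = pline R d0"
    using lines[THEN secants_plines] unfolding plines_def by blast
  have d0: "d0 \<in> vecs" using coords by (simp add: nzvecs_eq)
  have normalise: "\<exists>u\<in>nzvecs R. P = pspan R u \<and> herm u u = \<zero> \<and> vdot d0 u = \<one>"
    if "P \<in> hunital R q" "P \<notin> d" for P
  proof -
    obtain u where u: "u \<in> nzvecs R" "P = pspan R u" "herm u u = \<zero>" using \<open>P \<in> hunital R q\<close> hunitalE by blast
    then have uv: "u \<in> vecs" by (simp add: nzvecs_eq)
    define k where "k = vdot d0 u"
    have k: "k \<in> carrier R" "k \<noteq> \<zero>" using that u mem_pline_iff[of d0 u] coords d0 uv by (auto simp: k_def)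
    then have ku: "k \<in> Units R" using field_Units by simp
    note i = vscale_inverse[OF k uv]
    show ?thesis
    proof (intro bexI conjI)
      show "P = pspan R (vscale (inv k) u)" using pspan_eqI[OF uv i(1,2)] u by simp
      show "vscale (inv k) u \<in> nzvecs R"
        using u uv i vscale_eq_vzero_iff[OF uv i(1)] by (simp add: nzvecs_eq)
      show "herm (vscale (inv k) u) (vscale (inv k) u) = \<zero>" using u uv i by simp
      show "vdot d0 (vscale (inv k) u) = \<one>" using d0 uv i ku by (simp add: k_def[symmetric])
    qed
  qed
  \<comment> \<open>A line \<open>d\<close> through a corner would meet a side in that corner,
    making one of the triangles containing \<open>d\<close> degenerate.\<close>
  have notin: "meet b c \<notin> d" "meet a c \<notin> d" "meet a b \<notin> d"
    using meet_eq_iff[OF lines(2,4) ne(5)] meet_eq_iff[OF lines(1,4) ne(4)] meets bc ac ab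
    by (metis IntI)+
  obtain u1 where u1: "u1 \<in> nzvecs R" "meet b c = pspan R u1" "herm u1 u1 = \<zero>" "vdot d0 u1 = \<one>"
    using normalise[OF bc(1) notin(1)] by blast
  obtain u2 where u2: "u2 \<in> nzvecs R" "meet a c = pspan R u2" "herm u2 u2 = \<zero>" "vdot d0 u2 = \<one>"
    using normalise[OF ac(1) notin(2)] by blast
  obtain u3 where u3: "u3 \<in> nzvecs R" "meet a b = pspan R u3" "herm u3 u3 = \<zero>" "vdot d0 u3 = \<one>"
    using normalise[OF ab(1) notin(3)] by blast
  have car: "u1 \<in> vecs" "u2 \<in> vecs" "u3 \<in> vecs" "a0 \<in> vecs" "b0 \<in> vecs" "c0 \<in> vecs"
    using u1(1) u2(1) u3(1) coords(1-3) by (simp_all add: nzvecs_eq)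
  have dist: "pspan R u1 \<noteq> pspan R u2" "pspan R u2 \<noteq> pspan R u3" "pspan R u3 \<noteq> pspan R u1"
    using meets u1(2) u2(2) u3(2) by simp_all
  have inc: "vdot c0 u1 = \<zero>" "vdot c0 u2 = \<zero>" "vdot a0 u2 = \<zero>" "vdot a0 u3 = \<zero>" "vdot b0 u3 = \<zero>" "vdot b0 u1 = \<zero>"
    using mem_pline_iff[OF car(6) u1(1)] mem_pline_iff[OF car(6) u2(1)] mem_pline_iff[OF car(4) u2(1)]
      mem_pline_iff[OF car(4) u3(1)] mem_pline_iff[OF car(5) u3(1)] mem_pline_iff[OF car(5) u1(1)]
      bc ac ab u1(2) u2(2) u3(2) coords(5-7) by simp_all
  have "herm u2 u1 = \<ominus> herm u1 u2"
    using isotropic_diff[OF u1(1) u2(1) dist(1) coords(3) inc(1,2) coords(4) u1(4) u2(4) cd(1)] cd coords(7,8)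
    by (intro herm_skew_of_isotropic_diff car u1(3) u2(3)) simp
  moreover have "herm u3 u2 = \<ominus> herm u2 u3"
    using isotropic_diff[OF u2(1) u3(1) dist(2) coords(1) inc(3,4) coords(4) u2(4) u3(4) ad(1)] ad coords(5,8)
    by (intro herm_skew_of_isotropic_diff car u2(3) u3(3)) simp
  moreover have "herm u1 u3 = \<ominus> herm u3 u1"
    using isotropic_diff[OF u3(1) u1(1) dist(3) coords(2) inc(5,6) coords(4) u3(4) u1(4) bd(1)] bd coords(6,8)
    by (intro herm_skew_of_isotropic_diff car u3(3) u1(3)) simp
  \<comment> \<open>The line through \<open>u1\<close> and \<open>u2\<close> is \<open>c\<close>; if
    it contained \<open>u3\<close>, then \<open>a\<close> would meet \<open>b\<close> and
    \<open>c\<close> in the same point.\<close>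
  moreover have "vdot l u3 \<noteq> \<zero>" if l: "l \<in> nzvecs R" "vdot l u1 = \<zero>" "vdot l u2 = \<zero>" for l
  proof
    assume "vdot l u3 = \<zero>"
    have "pspan R l = pspan R c0"
      using perp_pspan_unique[OF u1(1) u2(1) dist(1) l coords(3) inc(1,2)] .
    then have "pline R l = c" using pline_eqI[OF l(1) coords(3)] coords(7) by simp
    moreover have "l \<in> vecs" using l by (simp add: nzvecs_eq)
    ultimately have "pspan R u3 \<in> c" using mem_pline_iff[OF _ u3(1), of l] \<open>vdot l u3 = \<zero>\<close> by simp
    then have "meet a c = meet a b"
      using meet_eq_iff[OF lines(1,3) ne(2)] ab(2) u3(2) by simp
    then show False using meets by simp
  qed
  ultimately show False
    using no_alternating_gram[OF u1(1) u2(1) u3(1) dist(1) u1(3) u2(3) u3(3)] by blast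
qed

section \<open>The Ramsey conclusions for the graph\<close>

theorem quasi_folkman:
  assumes "q \<ge> 4"
  shows "quasi_folkman_with (secants R q) (Hadj R q) (Htri R q)"
  unfolding quasi_folkman_with_def Htri_eq
proof (intro conjI allI ballI notI)
  fix t assume "t \<in> proper_triangles"
  then obtain l m n where "t = {l, m, n}" "proper_triangle l m n"
    unfolding proper_triangles_def by blast
  then show "is_triangle (secants R q) (Hadj R q) t"
    unfolding is_triangle_def proper_triangle_iff
    by (intro exI[of _ l] exI[of _ m] exI[of _ n]) (simp add: Hadj_def)
next
  fix col :: "('a \<times> 'a \<times> 'a) set set set \<Rightarrow> bool"
  have "q * card proper_triangles \<le>
      4 * q * card {t \<in> proper_triangles. monochromatic col t} + 3 * card proper_triangles"
    by (rule card_monochromatic)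
  \<comment> \<open>This is where q \<ge> 4 enters: for q > 3 the lower bound on the number of
    monochromatic triangles is positive.\<close>
  moreover have "3 * card proper_triangles < q * card proper_triangles"
    using assms card_triangles_pos by simp
  ultimately have "card {t \<in> proper_triangles. monochromatic col t} \<noteq> 0" by (intro notI) simp
  then have "{t \<in> proper_triangles. monochromatic col t} \<noteq> {}" by (metis card.empty)
  then show "\<exists>t\<in>proper_triangles. monochromatic col t" by blast
qed (use no_onan_configuration proper_triangle_of_mem in blast)

text \<open>The proportion is at least 1/4 - 3/(4q), and q \<ge> 1/\<epsilon> makes 3/(4q) at most
  \<epsilon>.\<close>

theorem card_monochromatic_Htri:
  assumes "\<epsilon> > 0" "1 / \<epsilon> \<le> real q"
  shows "real (card {t \<in> Htri R q. monochromatic col t}) \<ge> (1 / 4 - \<epsilon>) * real (card (Htri R q))"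
proof -
  define M T where "M = real (card {t \<in> Htri R q. monochromatic col t})" and "T = real (card (Htri R q))"
  have "real (q * card (Htri R q)) \<le>
      real (4 * q * card {t \<in> Htri R q. monochromatic col t} + 3 * card (Htri R q))"
    unfolding Htri_eq using card_monochromatic by (intro of_nat_mono)
  then have 1: "real q * T \<le> 4 * real q * M + 3 * T" by (simp add: M_def T_def)
  have "1 \<le> \<epsilon> * real q" using assms by (simp add: field_simps)
  then have "1 * T \<le> \<epsilon> * real q * T" by (intro mult_right_mono) (auto simp: T_def)
  moreover have "T \<ge> 0" by (simp add: T_def)
  ultimately have "real q * ((1 / 4 - \<epsilon>) * T) \<le> real q * M"
    using 1 by (simp add: algebra_simps)
  then show ?thesis
    using q_ge_2 unfolding M_def[symmetric] T_def[symmetric] by simp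
qed

end

theorem theorem1:
  shows "(\<forall>q (R :: 'a ring). is_prime_power q \<and> q \<ge> 4 \<and> field R \<and> finite (carrier R) \<and>
            card (carrier R) = q ^ 2 \<longrightarrow>
            card (secants R q) = q ^ 4 - q ^ 3 + q ^ 2 \<and>
            quasi_folkman_with (secants R q) (Hadj R q) (Htri R q))
       \<and> (\<forall>\<epsilon> :: real. \<epsilon> > 0 \<longrightarrow> (\<exists>Q :: nat. \<forall>q (R :: 'a ring) (col :: ('a \<times> 'a \<times> 'a) set set set \<Rightarrow> bool).
            is_prime_power q \<and> q \<ge> Q \<and> field R \<and> finite (carrier R) \<and> card (carrier R) = q ^ 2 \<longrightarrow>
            real (card {t \<in> Htri R q. monochromatic col t}) \<ge> (1 / 4 - \<epsilon>) * real (card (Htri R q))))"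
proof (intro conjI allI impI)
  fix q and R :: "'a ring"
  assume *: "is_prime_power q \<and> q \<ge> 4 \<and> field R \<and> finite (carrier R) \<and> card (carrier R) = q ^ 2"
  then interpret hermitian_plane R q
    by (simp add: hermitian_plane_def hermitian_plane_axioms_def)
  show "card (secants R q) = q ^ 4 - q ^ 3 + q ^ 2" by (rule card_L)
  show "quasi_folkman_with (secants R q) (Hadj R q) (Htri R q)" using quasi_folkman * by blast
next
  fix \<epsilon> :: real assume \<epsilon>: "\<epsilon> > 0"
  show "\<exists>Q :: nat. \<forall>q (R :: 'a ring) (col :: ('a \<times> 'a \<times> 'a) set set set \<Rightarrow> bool).
            is_prime_power q \<and> q \<ge> Q \<and> field R \<and> finite (carrier R) \<and> card (carrier R) = q ^ 2 \<longrightarrow>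
            real (card {t \<in> Htri R q. monochromatic col t}) \<ge> (1 / 4 - \<epsilon>) * real (card (Htri R q))"
  proof (intro exI allI impI)
    fix q and R :: "'a ring" and col :: "('a \<times> 'a \<times> 'a) set set set \<Rightarrow> bool"
    \<comment> \<open>The threshold \<open>Q\<close> is fixed here as the ceiling of 1/\<epsilon>,
      the same for all fields and all colourings.\<close>
    assume *: "is_prime_power q \<and> q \<ge> nat \<lceil>1 / \<epsilon>\<rceil> \<and> field R \<and> finite (carrier R) \<and> card (carrier R) = q ^ 2"
    then interpret hermitian_plane R q
      by (simp add: hermitian_plane_def hermitian_plane_axioms_def)
    have "1 / \<epsilon> \<le> real q" using * by linarith
    then show "real (card {t \<in> Htri R q. monochromatic col t}) \<ge> (1 / 4 - \<epsilon>) * real (card (Htri R q))"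
      using card_monochromatic_Htri \<epsilon> by blast
  qed
qed

end
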